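(* Let $\mathfrak{B}$ be an atomic base with associated domain of individuals $D_\mathfrak{B}$, let $\Lambda$ be a language of grounding over $\mathfrak{B}$, let $den^*$ be a denotation function for the alphabet of $\Lambda$, and let $den$ be the denotation function for the terms of $\Lambda$ associated to $den^*$. Let $U : \beta$ be a term of $\Lambda$ with $FV^I(U) = \{x_1, \dots, x_n\}$ and $FV^T(U) = \{\xi^{\alpha_1}, \dots, \xi^{\alpha_m}\}$, and let $\{\alpha_s, \dots, \alpha_t\}$ be the set of formulas occurring as types of the elements of $FV^T(U)$. Then $den(U)$ is a ground on $\mathfrak{B}$ for the assertion $\alpha_s, \dots, \alpha_t \vdash \beta$, defined on $n$ individuals of $D_\mathfrak{B}$.
   Context: Background language $L$: a first-order language with individual variables, individual and relational constants, the atomic absurdity constant $\bot$ and logical constants $\wedge, \vee, \rightarrow, \forall, \exists$ ($\neg\alpha := \alpha\rightarrow\bot$). An atomic system is a pair $\langle L, \mathfrak{R}\rangle$ with $\mathfrak{R}$ a recursively axiomatisable set of rules $\alpha_1,\dots,\alpha_n / \beta$, where the $\alpha_i$ are atomic formulas other than $\bot$, $\beta$ is atomic or $\bot$, and every free variable of $\beta$ is free in some $\alpha_i$. An atomic base $\mathfrak{B}$ on $L$ consists of the individual constants and relational constants of $L$ together with an atomic system $\texttt{S}$ whose language is contained in $L$; a domain of individuals $D_\mathfrak{B}$ is associated to it. Grounds on $\mathfrak{B}$ for categorical assertions $\vdash\alpha$ ($\alpha$ closed) are defined inductively: a ground for atomic $\alpha$ is a derivation of $\alpha$ in $\texttt{S}$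 with no undischarged assumptions and no unbound individual variables; $\wedge I(g_1,g_2)$ is a ground for $\alpha\wedge\beta$ iff $g_1,g_2$ are grounds for $\alpha,\beta$; $\vee I[\alpha_i\rhd\alpha_1\vee\alpha_2](g)$ is a ground for $\alpha_1\vee\alpha_2$ iff $g$ is a ground for $\alpha_i$; $\rightarrow I\xi^\alpha(f)$ is a ground for $\alpha\rightarrow\beta$ iff $f$ is a ground for the hypothetical assertion $\alpha\vdash\beta$; $\exists I(g)$ is a ground for $\exists x\alpha(x)$ iff $g$ is a ground for $\alpha(t)$; $\forall I x(f)$ is a ground for $\forall x\alpha(x)$ iff $f$ is a ground for the general assertion $\vdash\alpha(x)$; there is no ground for $\bot$; nothing else is a closed ground. These $\wedge I,\vee I,\rightarrow I,\exists I,\forall I$ are the primitive operations. A $\mathfrak{B}$-operation on grounds of operational type $\alpha_1(\underline{x}_1),\dots,\alpha_n(\underline{x}_n)\rhd\beta(\underline{x})$ ($n\ge 0$) is a total constructive function, given by defining equations, which, applied to individuals of $D_\mathfrak{B}$ for its individual variables and to grounds on $\mathfrak{B}$ for the resulting closed instances of the $\alpha_i$, yields a ground on $\mathfrak{B}$ for the corresponding closed instance of $\beta$; it is then called a ground on $\mathfrak{B}$ for the (general, hypothetical or general-hypothetical) assertion $\alpha_1,\dots,\alpha_n\vdash\beta$, and it is "defined on" the number of individuals it takes as arguments (possibly more than the variables occurring in its type). Second-level operations have types $\tau_1,\dots,\tau_n\rhd\tau_{n+1}$ whose entries may themselves be first-level types $\Gamma\rhd\gamma$, take first-level operations as arguments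 for such entries, and may bind individual variables and typed variables (discharge assumptions) on specific entries. Language of grounding $\Lambda$ over $\mathfrak{B}$: its alphabet contains an individual constant $\delta_i$ naming the $i$-th derivation of $\texttt{S}$ with no undischarged assumptions and unbound individual variables; typed variables $\xi^\alpha_i$ ($\alpha$ a formula of $L$); and operational symbols $F[\tau]$, each a label attached to an operational type $\tau$ (finitely many, or finitely many per scheme of types), possibly binding individual and typed variables on entries, subject to the requirement that there exists a $\mathfrak{B}$-operation on grounds of that type with the same bindings. Terms are typed: $\delta:\alpha$ ($\alpha$ the conclusion of the named derivation), $\xi^\alpha:\alpha$, and if $\phi$ has type $\alpha_1(\underline{x}_1),\dots,\alpha_n(\underline{x}_n)\rhd\beta(\underline{x}_{n+1})$ binding $\underline{x}$ and $\underline{\xi}$, then from $U_i:\alpha_i(\underline{x}_i)$ one forms $\phi\,\underline{x}\,\underline{\xi}\,(U_1,\dots,U_n):\beta(\underline{x}_{n+1})$ (with the usual eigenvariable restrictions for quantifiers). $FV^I(U)$ and $FV^T(U)$ are the free individual and free typed variables of $U$. The operational symbols $\wedge I,\vee I,\rightarrow I,\exists I,\forall I,\bot_\alpha$ are called primitive. A denotation for the alphabet $den^*$: $den^*(\delta_i)$ is the derivation named by $\delta_i$; $den^*(\xi^\alpha)$ is the identity $\mathfrak{B}$-operation of type $\alpha\rhd\alpha$; $den^*(\phi)$ is the primitive operation of the same label if $\phi$ is primitive, and otherwise one of the $\mathfrak{B}$-operations on grounds of the type of $\phi$ (symbols whose types are instances of one scheme get operations whose defining equations are instances of one scheme). The associated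 denotation for terms: $den(\delta)=den^*(\delta)$, $den(\xi^\alpha)=den^*(\xi^\alpha)$, $den(\phi\,\underline{x}\,\underline{\xi}\,(U_1,\dots,U_n)) = den^*(\phi)(\underline{y}, den(U_1),\dots,den(U_n))$, where $\underline{y}$ are the individual variables of the type of $den^*(\phi)$ (of the co-domains of its entries, for second-level operations).
   Formalization: The constants δ_i name only derivations of S whose conclusion is not ⊥ (if S derives ⊥, δ:⊥ would denote no ground, so the claim fails); each individual of D_B is assumed to be named by an individual constant of L, so that closed instances make sense. *)

theory Defs
  imports Main
begin

section \<open>The background language\<close>

datatype trm = Var nat | Cst nat

datatype fm =
    Atom nat "trm list"
  | Bot
  | And fm fm
  | Or fm fm
  | Imp fm fm
  | All nat fm
  | Ex nat fm

primrec fv_trm :: "trm \<Rightarrow> nat set" where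
  "fv_trm (Var x) = {x}"
| "fv_trm (Cst c) = {}"

primrec fv :: "fm \<Rightarrow> nat set" where
  "fv (Atom r ts) = (\<Union>t\<in>set ts. fv_trm t)"
| "fv Bot = {}"
| "fv (And A B) = fv A \<union> fv B"
| "fv (Or A B) = fv A \<union> fv B"
| "fv (Imp A B) = fv A \<union> fv B"
| "fv (All x A) = fv A - {x}"
| "fv (Ex x A) = fv A - {x}"

primrec sub_trm :: "(nat \<Rightarrow> trm) \<Rightarrow> trm \<Rightarrow> trm" where
  "sub_trm \<sigma> (Var x) = \<sigma> x"
| "sub_trm \<sigma> (Cst c) = Cst c"

text \<open>Simultaneous substitution for the free variables, without renaming of bound variables: it
  is only used with closed terms, or under the proviso \<open>free_for\<close>.\<close>

primrec sub :: "(nat \<Rightarrow> trm) \<Rightarrow> fm \<Rightarrow> fm" where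
  "sub \<sigma> (Atom r ts) = Atom r (map (sub_trm \<sigma>) ts)"
| "sub \<sigma> Bot = Bot"
| "sub \<sigma> (And A B) = And (sub \<sigma> A) (sub \<sigma> B)"
| "sub \<sigma> (Or A B) = Or (sub \<sigma> A) (sub \<sigma> B)"
| "sub \<sigma> (Imp A B) = Imp (sub \<sigma> A) (sub \<sigma> B)"
| "sub \<sigma> (All x A) = All x (sub (\<sigma>(x := Var x)) A)"
| "sub \<sigma> (Ex x A) = Ex x (sub (\<sigma>(x := Var x)) A)"

definition subst :: "nat \<Rightarrow> trm \<Rightarrow> fm \<Rightarrow> fm" where
  "subst x t A = sub (Var(x := t)) A"

primrec free_for :: "trm \<Rightarrow> nat \<Rightarrow> fm \<Rightarrow> bool" where
  "free_for t x (Atom r ts) = True"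
| "free_for t x Bot = True"
| "free_for t x (And A B) = (free_for t x A \<and> free_for t x B)"
| "free_for t x (Or A B) = (free_for t x A \<and> free_for t x B)"
| "free_for t x (Imp A B) = (free_for t x A \<and> free_for t x B)"
| "free_for t x (All y A) = (x \<notin> fv (All y A) \<or> (y \<notin> fv_trm t \<and> free_for t x A))"
| "free_for t x (Ex y A) = (x \<notin> fv (Ex y A) \<or> (y \<notin> fv_trm t \<and> free_for t x A))"

lemma size_sub [simp]: "size (sub \<sigma> A) = size A"
  by (induction A arbitrary: \<sigma>) auto

lemma size_subst [simp]: "size (subst x t A) = size A"
  by (simp add: subst_def)

record lang =
  consts_of :: "nat set"
  rels_of :: "(nat \<times> nat) set"  \<comment> \<open>relational constants with their arities\<close>

primrec wf_trm :: "lang \<Rightarrow> trm \<Rightarrow> bool" where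
  "wf_trm L (Var x) = True"
| "wf_trm L (Cst c) = (c \<in> consts_of L)"

primrec wf_fm :: "lang \<Rightarrow> fm \<Rightarrow> bool" where
  "wf_fm L (Atom r ts) = ((r, length ts) \<in> rels_of L \<and> (\<forall>t\<in>set ts. wf_trm L t))"
| "wf_fm L Bot = True"
| "wf_fm L (And A B) = (wf_fm L A \<and> wf_fm L B)"
| "wf_fm L (Or A B) = (wf_fm L A \<and> wf_fm L B)"
| "wf_fm L (Imp A B) = (wf_fm L A \<and> wf_fm L B)"
| "wf_fm L (All x A) = wf_fm L A"
| "wf_fm L (Ex x A) = wf_fm L A"

text \<open>A typed variable \<open>\<xi>\<^sub>i\<close> of type \<open>\<alpha>\<close> is the pair \<open>(i, \<alpha>)\<close>.\<close>

type_synonym tvar = "nat \<times> fm"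


section \<open>Constructive functions given by defining equations\<close>

text \<open>
  Constructive functions are the functions programmable in the following call-by-value language of
  equations over free constructors. \<open>EFun f eqs\<close> is the function \<open>f\<close> with the defining equations
  \<open>f p\<^sub>1 \<dots> p\<^sub>n = e\<close>, for \<open>([p\<^sub>1, \<dots>, p\<^sub>n], e)\<close> in \<open>eqs\<close>; the expressions \<open>e\<close> may contain \<open>f\<close>, and the
  first equation that matches is used. A function value \<open>Clo \<rho> f eqs\<close> carries in addition the
  values \<open>\<rho>\<close> of its parameters. Functions can be applied, but not inspected. Syntactic objects
  (numbers, formulas, derivations) are data, given by the functions \<open>q_\<dots>\<close> below; numbers are unary,
  so that finitely many equations suffice to compute with them.
  \<open>EMeta\<close> is a metavariable of an equation scheme and has no value.
\<close>

datatype con =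
    CZero | CSuc | CNil | CCons | CPair | CVar | CCst
  | CAtom | CBot | CAnd | COr | CImp | CAll | CEx
  | CDer | CAndI | COrI1 | COrI2 | CImpI | CExI | CAllI

datatype pvar =
    IV nat    \<comment> \<open>individual variable of the background language\<close>
  | TV tvar   \<comment> \<open>typed variable\<close>
  | FV fm     \<comment> \<open>argument place for a ground for (an instance of) a formula\<close>
  | LV nat

datatype meta = MFm nat | MVar nat | MTrm nat

datatype pat = PVar pvar | PCon con "pat list"

datatype exp =
    EVar pvar
  | EMeta meta
  | EVal val
  | ECon con "exp list"
  | EFun pvar "(pat list \<times> exp) list"
  | EApp exp "exp list"
and val =
    Con con "val list"
  | Clo "(pvar \<times> val) list" pvar "(pat list \<times> exp) list"

type_synonym eqns = "(pat list \<times> exp) list"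
type_synonym env = "(pvar \<times> val) list"

fun match :: "pat \<Rightarrow> val \<Rightarrow> env option"
  and matches :: "pat list \<Rightarrow> val list \<Rightarrow> env option" where
  "match (PVar x) v = Some [(x, v)]"
| "match (PCon c ps) (Con c' vs) = (if c = c' then matches ps vs else None)"
| "match (PCon c ps) (Clo \<rho> f eqs) = None"
| "matches [] [] = Some []"
| "matches (p # ps) (v # vs) =
     (case match p v of None \<Rightarrow> None
      | Some \<theta> \<Rightarrow> (case matches ps vs of None \<Rightarrow> None | Some \<theta>' \<Rightarrow> Some (\<theta> @ \<theta>')))"
| "matches [] (v # vs) = None"
| "matches (p # ps) [] = None"

fun first_match :: "eqns \<Rightarrow> val list \<Rightarrow> (env \<times> exp) option" where
  "first_match [] vs = None"
| "first_match ((ps, e) # eqs) vs =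
     (case matches ps vs of Some \<theta> \<Rightarrow> Some (\<theta>, e) | None \<Rightarrow> first_match eqs vs)"

text \<open>
  \<open>app f vs v\<close>: the value of \<open>f\<close> on the arguments \<open>vs\<close> is \<open>v\<close>. A function of no arguments is
  identified with its value.
\<close>

inductive eval :: "env \<Rightarrow> exp \<Rightarrow> val \<Rightarrow> bool"
  and app :: "val \<Rightarrow> val list \<Rightarrow> val \<Rightarrow> bool" where
  eval_EVar: "map_of \<rho> x = Some v \<Longrightarrow> eval \<rho> (EVar x) v"
| eval_EVal: "eval \<rho> (EVal v) v"
| eval_ECon: "list_all2 (eval \<rho>) es vs \<Longrightarrow> eval \<rho> (ECon c es) (Con c vs)"
| eval_EFun: "eval \<rho> (EFun f eqs) (Clo \<rho> f eqs)"
| eval_EApp: "eval \<rho> e u \<Longrightarrow> list_all2 (eval \<rho>) es vs \<Longrightarrow> app u vs v \<Longrightarrow> eval \<rho> (EApp e es) v"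
| app_Nil: "app u [] u"
| app_Clo: "vs \<noteq> [] \<Longrightarrow> first_match eqs vs = Some (\<theta>, e) \<Longrightarrow>
     eval (\<theta> @ (f, Clo \<rho> f eqs) # \<rho>) e v \<Longrightarrow> app (Clo \<rho> f eqs) vs v"

text \<open>Evaluation is functional, so programs define (partial) functions.\<close>

lemma list_all2_det: "list_all2 (\<lambda>e v. P e v \<and> (\<forall>v'. P e v' \<longrightarrow> v = v')) es vs \<Longrightarrow> list_all2 P es vs' \<Longrightarrow> vs = vs'"
proof (induction es vs arbitrary: vs' rule: list_all2_induct)
  case Nil then show ?case by simp
next
  case (Cons e es v vs) then show ?case by (auto simp: list_all2_Cons1)
qed

lemma eval_det: "eval \<rho> e v \<Longrightarrow> eval \<rho> e v' \<Longrightarrow> v = v'"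
  and app_det: "app f vs v \<Longrightarrow> app f vs v' \<Longrightarrow> v = v'"
proof (induction arbitrary: v' and v' rule: eval_app.inducts)
  case (eval_ECon \<rho> es vs c)
  from eval_ECon.prems obtain vs' where "list_all2 (eval \<rho>) es vs'" "v' = Con c vs'" by (auto elim: eval.cases)
  with eval_ECon.IH list_all2_det[of "eval \<rho>" es vs vs'] show ?case by auto
next
  case (eval_EApp \<rho> e u es vs v)
  from eval_EApp.prems obtain u' vs' where *: "eval \<rho> e u'" "list_all2 (eval \<rho>) es vs'" "app u' vs' v'"
    by (auto elim: eval.cases)
  with eval_EApp.IH list_all2_det[of "eval \<rho>" es vs vs'] have "u = u'" "vs = vs'" by auto
  then have "app u vs v'" using * by simp
  then show ?case by (rule eval_EApp.IH)
next
  case (app_Clo vs eqs \<theta> e f \<rho> v)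
  from app_Clo.prems app_Clo.hyps have "eval (\<theta> @ (f, Clo \<rho> f eqs) # \<rho>) e v'" by cases auto
  then show ?case by (rule app_Clo.IH)
qed (auto elim: eval.cases app.cases)

definition lam :: "pvar list \<Rightarrow> exp \<Rightarrow> exp" where
  "lam xs e = (if xs = [] then e else EFun (LV 0) [(map PVar xs, e)])"

text \<open>The value \<open>u\<close> is the function (or, for no arguments, the object) \<open>f\<close> defined by the
  equations \<open>eqs\<close> with parameters \<open>\<rho>\<close>.\<close>

definition defined_by :: "env \<Rightarrow> pvar \<Rightarrow> eqns \<Rightarrow> val \<Rightarrow> bool" where
  "defined_by \<rho> f eqs u \<longleftrightarrow> u = Clo \<rho> f eqs \<or> (\<exists>e. eqs = [([], e)] \<and> eval \<rho> e u)"

primrec q_nat :: "nat \<Rightarrow> val" where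
  "q_nat 0 = Con CZero []"
| "q_nat (Suc n) = Con CSuc [q_nat n]"

primrec q_list :: "('a \<Rightarrow> val) \<Rightarrow> 'a list \<Rightarrow> val" where
  "q_list q [] = Con CNil []"
| "q_list q (a # as) = Con CCons [q a, q_list q as]"

primrec q_trm :: "trm \<Rightarrow> val" where
  "q_trm (Var x) = Con CVar [q_nat x]"
| "q_trm (Cst c) = Con CCst [q_nat c]"

primrec q_fm :: "fm \<Rightarrow> val" where
  "q_fm (Atom r ts) = Con CAtom [q_nat r, q_list q_trm ts]"
| "q_fm Bot = Con CBot []"
| "q_fm (And A B) = Con CAnd [q_fm A, q_fm B]"
| "q_fm (Or A B) = Con COr [q_fm A, q_fm B]"
| "q_fm (Imp A B) = Con CImp [q_fm A, q_fm B]"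
| "q_fm (All x A) = Con CAll [q_nat x, q_fm A]"
| "q_fm (Ex x A) = Con CEx [q_nat x, q_fm A]"

text \<open>Expressions for the instance of a term or formula under the current values of the individual
  variables in \<open>V\<close>.\<close>

fun x_trm :: "nat set \<Rightarrow> trm \<Rightarrow> exp" where
  "x_trm V (Var x) = (if x \<in> V then EVar (IV x) else EVal (q_trm (Var x)))"
| "x_trm V (Cst c) = EVal (q_trm (Cst c))"

primrec x_list :: "('a \<Rightarrow> exp) \<Rightarrow> 'a list \<Rightarrow> exp" where
  "x_list q [] = ECon CNil []"
| "x_list q (a # as) = ECon CCons [q a, x_list q as]"

primrec x_fm :: "nat set \<Rightarrow> fm \<Rightarrow> exp" where
  "x_fm V (Atom r ts) = ECon CAtom [EVal (q_nat r), x_list (x_trm V) ts]"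
| "x_fm V Bot = ECon CBot []"
| "x_fm V (And A B) = ECon CAnd [x_fm V A, x_fm V B]"
| "x_fm V (Or A B) = ECon COr [x_fm V A, x_fm V B]"
| "x_fm V (Imp A B) = ECon CImp [x_fm V A, x_fm V B]"
| "x_fm V (All x A) = ECon CAll [EVal (q_nat x), x_fm (V - {x}) A]"
| "x_fm V (Ex x A) = ECon CEx [EVal (q_nat x), x_fm (V - {x}) A]"


section \<open>Atomic systems and atomic bases\<close>

type_synonym rule = "fm list \<times> fm"  \<comment> \<open>premises and conclusion\<close>

definition is_atom :: "fm \<Rightarrow> bool" where
  "is_atom A \<longleftrightarrow> (\<exists>r ts. A = Atom r ts)"

definition q_rule :: "rule \<Rightarrow> val" where
  "q_rule r = Con CPair [q_list q_fm (fst r), q_fm (snd r)]"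

text \<open>Recursively axiomatisable means recursively enumerable: membership has a positive test.\<close>

definition recursively_axiomatisable :: "rule set \<Rightarrow> bool" where
  "recursively_axiomatisable R \<longleftrightarrow> (\<exists>f. \<forall>r. r \<in> R \<longleftrightarrow> (\<exists>v. app f [q_rule r] v))"

record asys =
  lang_of :: lang
  rules_of :: "rule set"

definition atomic_system :: "asys \<Rightarrow> bool" where
  "atomic_system S \<longleftrightarrow>
     recursively_axiomatisable (rules_of S) \<and>
     (\<forall>(As, B)\<in>rules_of S.
        (\<forall>A\<in>set As. is_atom A \<and> wf_fm (lang_of S) A) \<and>
        (is_atom B \<or> B = Bot) \<and> wf_fm (lang_of S) B \<and>
        fv B \<subseteq> (\<Union>A\<in>set As. fv A))"

datatype deriv = Node (concl: fm) (subderivs: "deriv list")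

text \<open>
  Derivations without undischarged assumptions and without free individual variables. The variables
  of a rule are schematic; by the condition on the variables of a rule, no variable could
  otherwise ever occur in such a derivation.
\<close>

inductive derivation :: "asys \<Rightarrow> deriv \<Rightarrow> bool" for S where
  "(As, B) \<in> rules_of S \<Longrightarrow> map concl Ds = map (sub \<theta>) As \<Longrightarrow> A = sub \<theta> B \<Longrightarrow> fv A = {} \<Longrightarrow>
   (\<forall>D\<in>set Ds. derivation S D) \<Longrightarrow> derivation S (Node A Ds)"

fun q_deriv :: "deriv \<Rightarrow> val" where
  "q_deriv (Node A Ds) = Con CDer [q_fm A, q_list id (map q_deriv Ds)]"

text \<open>Each individual of the domain has an individual constant as its name.\<close>

record 'd base =
  blang :: lang
  bsys :: asys
  bdom :: "'d set"
  bname :: "'d \<Rightarrow> nat"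

definition atomic_base :: "'d base \<Rightarrow> bool" where
  "atomic_base B \<longleftrightarrow>
     atomic_system (bsys B) \<and>
     consts_of (lang_of (bsys B)) \<subseteq> consts_of (blang B) \<and>
     rels_of (lang_of (bsys B)) \<subseteq> rels_of (blang B) \<and>
     bij_betw (bname B) (bdom B) (consts_of (blang B))"

definition ind :: "'d base \<Rightarrow> 'd \<Rightarrow> val" where
  "ind B d = q_trm (Cst (bname B d))"


section \<open>Grounds and operations on grounds\<close>

text \<open>
  \<open>ground B A g\<close>: \<open>g\<close> is a ground on \<open>B\<close> for the categorical assertion of the closed formula \<open>A\<close>.
  The labels that distinguish primitive operations (the disjuncts of \<open>\<or>I\<close>, the type of the variable
  bound by \<open>\<rightarrow>I\<close>, the instantiating term of \<open>\<exists>I\<close>) are part of the ground.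
\<close>

function ground :: "'d base \<Rightarrow> fm \<Rightarrow> val \<Rightarrow> bool" where
  "ground B (Atom r ts) g \<longleftrightarrow>
     (\<exists>D. derivation (bsys B) D \<and> concl D = Atom r ts \<and> g = q_deriv D)"
| "ground B Bot g \<longleftrightarrow> False"
| "ground B (And A1 A2) g \<longleftrightarrow>
     (\<exists>g1 g2. g = Con CAndI [g1, g2] \<and> ground B A1 g1 \<and> ground B A2 g2)"
| "ground B (Or A1 A2) g \<longleftrightarrow>
     (\<exists>h. g = Con COrI1 [q_fm A1, q_fm A2, h] \<and> ground B A1 h) \<or>
     (\<exists>h. g = Con COrI2 [q_fm A1, q_fm A2, h] \<and> ground B A2 h)"
| "ground B (Imp A1 A2) g \<longleftrightarrow>
     (\<exists>f. g = Con CImpI [q_fm A1, f] \<and>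
        (\<forall>h. ground B A1 h \<longrightarrow> (\<exists>v. app f [h] v \<and> ground B A2 v)))"
| "ground B (Ex x A) g \<longleftrightarrow>
     (\<exists>c h. g = Con CExI [q_trm (Cst c), h] \<and> c \<in> consts_of (blang B) \<and>
        ground B (subst x (Cst c) A) h)"
| "ground B (All x A) g \<longleftrightarrow>
     (\<exists>f. g = Con CAllI [f] \<and>
        (\<forall>d\<in>bdom B. \<exists>v. app f [ind B d] v \<and> ground B (subst x (Cst (bname B d)) A) v))"
  by pat_completeness auto
termination
  by (relation "measure (\<lambda>(B, A, g). size A)") auto

text \<open>
  An operational type has a list of entries and a co-domain. An entry \<open>Entry xs \<Gamma> \<alpha>\<close> is the
  first-level type \<open>\<Gamma> \<rhd> \<alpha>\<close>, on which the individual variables \<open>xs\<close> and typed variables of the types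
  \<open>\<Gamma>\<close> are bound. If no entry binds anything, the type is of the first level.
\<close>

datatype ('x, 'f) entry = Entry (ebind: "'x list") (edis: "'f list") (econ: 'f)
datatype ('x, 'f) optype = OpT (entries: "('x, 'f) entry list") (codom: 'f)

type_synonym oty = "(nat, fm) optype"

definition fv_entry :: "(nat, fm) entry \<Rightarrow> nat set" where
  "fv_entry e = (fv (econ e) \<union> (\<Union>A\<in>set (edis e). fv A)) - set (ebind e)"

definition fv_oty :: "oty \<Rightarrow> nat set" where
  "fv_oty \<tau> = fv (codom \<tau>) \<union> (\<Union>e\<in>set (entries \<tau>). fv_entry e)"

definition wf_oty :: "lang \<Rightarrow> oty \<Rightarrow> bool" where
  "wf_oty L \<tau> \<longleftrightarrow> wf_fm L (codom \<tau>) \<and>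
     (\<forall>e\<in>set (entries \<tau>). distinct (ebind e) \<and> wf_fm L (econ e) \<and> (\<forall>A\<in>set (edis e). wf_fm L A))"

text \<open>\<open>\<sigma>\<close> modified so that the variables \<open>xs\<close> stand for (the names of) the individuals \<open>ds\<close>\<close>

definition bnd :: "'d base \<Rightarrow> nat list \<Rightarrow> 'd list \<Rightarrow> (nat \<Rightarrow> trm) \<Rightarrow> nat \<Rightarrow> trm" where
  "bnd B xs ds \<sigma> x = (case map_of (zip xs ds) x of Some d \<Rightarrow> Cst (bname B d) | None \<Rightarrow> \<sigma> x)"

text \<open>The operations of first-level type \<open>\<Gamma> \<rhd> \<alpha>\<close> on individuals for \<open>xs\<close>, where the remaining
  individual variables are instantiated by \<open>\<sigma>\<close>. With \<open>xs\<close> and \<open>\<Gamma>\<close> empty: the grounds for \<open>\<alpha>\<close>.\<close>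

definition entry_arg :: "'d base \<Rightarrow> (nat \<Rightarrow> trm) \<Rightarrow> (nat, fm) entry \<Rightarrow> val \<Rightarrow> bool" where
  "entry_arg B \<sigma> e f \<longleftrightarrow>
     (\<forall>ds gs. length ds = length (ebind e) \<and> set ds \<subseteq> bdom B \<and>
        list_all2 (\<lambda>A. ground B (sub (bnd B (ebind e) ds \<sigma>) A)) (edis e) gs \<longrightarrow>
        (\<exists>v. app f (map (ind B) ds @ gs) v \<and> ground B (sub (bnd B (ebind e) ds \<sigma>) (econ e)) v))"

text \<open>\<open>f\<close> is an operation on grounds on \<open>B\<close> of type \<open>\<tau>\<close>, defined on individuals for the variables
  \<open>xs\<close>, which include those of \<open>\<tau>\<close>.\<close>

definition operation :: "'d base \<Rightarrow> nat list \<Rightarrow> oty \<Rightarrow> val \<Rightarrow> bool" where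
  "operation B xs \<tau> f \<longleftrightarrow>
     distinct xs \<and> fv_oty \<tau> \<subseteq> set xs \<and>
     (\<forall>ds as. length ds = length xs \<and> set ds \<subseteq> bdom B \<and>
        list_all2 (entry_arg B (bnd B xs ds Var)) (entries \<tau>) as \<longrightarrow>
        (\<exists>v. app f (map (ind B) ds @ as) v \<and> ground B (sub (bnd B xs ds Var) (codom \<tau>)) v))"

text \<open>\<open>f\<close> is a ground on \<open>B\<close> for the assertion \<open>\<Gamma> \<turnstile> \<beta>\<close>, defined on individuals for the variables \<open>xs\<close>,
  and therefore on \<open>length xs\<close> individuals.\<close>

definition ground_for :: "'d base \<Rightarrow> nat list \<Rightarrow> fm list \<Rightarrow> fm \<Rightarrow> val \<Rightarrow> bool" where
  "ground_for B xs \<Gamma> \<beta> f \<longleftrightarrow> operation B xs (OpT (map (Entry [] []) \<Gamma>) \<beta>) f"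


section \<open>Schemes of types\<close>

datatype svar = SVar nat | SMVar nat
datatype strm = STVar svar | STCst nat | SMTrm nat
datatype sfm =
    SMFm nat
  | SAtom nat "strm list"
  | SBot
  | SAnd sfm sfm
  | SOr sfm sfm
  | SImp sfm sfm
  | SAll svar sfm
  | SEx svar sfm
  | SSub svar strm sfm

text \<open>An instantiation lists the values of the metavariables for formulas, individual variables
  and terms. A scheme of types comes with the numbers of its metavariables.\<close>

datatype minst = MI (mfms: "fm list") (mvars: "nat list") (mtrms: "trm list")

type_synonym scheme = "(nat \<times> nat \<times> nat) \<times> (svar, sfm) optype"

primrec i_var :: "minst \<Rightarrow> svar \<Rightarrow> nat" where
  "i_var \<mu> (SVar x) = x"
| "i_var \<mu> (SMVar j) = mvars \<mu> ! j"

primrec i_trm :: "minst \<Rightarrow> strm \<Rightarrow> trm" where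
  "i_trm \<mu> (STVar x) = Var (i_var \<mu> x)"
| "i_trm \<mu> (STCst c) = Cst c"
| "i_trm \<mu> (SMTrm j) = mtrms \<mu> ! j"

primrec i_fm :: "minst \<Rightarrow> sfm \<Rightarrow> fm" where
  "i_fm \<mu> (SMFm j) = mfms \<mu> ! j"
| "i_fm \<mu> (SAtom r ts) = Atom r (map (i_trm \<mu>) ts)"
| "i_fm \<mu> SBot = Bot"
| "i_fm \<mu> (SAnd A B) = And (i_fm \<mu> A) (i_fm \<mu> B)"
| "i_fm \<mu> (SOr A B) = Or (i_fm \<mu> A) (i_fm \<mu> B)"
| "i_fm \<mu> (SImp A B) = Imp (i_fm \<mu> A) (i_fm \<mu> B)"
| "i_fm \<mu> (SAll x A) = All (i_var \<mu> x) (i_fm \<mu> A)"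
| "i_fm \<mu> (SEx x A) = Ex (i_var \<mu> x) (i_fm \<mu> A)"
| "i_fm \<mu> (SSub x t A) = subst (i_var \<mu> x) (i_trm \<mu> t) (i_fm \<mu> A)"

primrec ok_var :: "minst \<Rightarrow> svar \<Rightarrow> bool" where
  "ok_var \<mu> (SVar x) = True"
| "ok_var \<mu> (SMVar j) = (j < length (mvars \<mu>))"

primrec ok_trm :: "minst \<Rightarrow> strm \<Rightarrow> bool" where
  "ok_trm \<mu> (STVar x) = ok_var \<mu> x"
| "ok_trm \<mu> (STCst c) = True"
| "ok_trm \<mu> (SMTrm j) = (j < length (mtrms \<mu>))"

primrec ok_fm :: "minst \<Rightarrow> sfm \<Rightarrow> bool" where
  "ok_fm \<mu> (SMFm j) = (j < length (mfms \<mu>))"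
| "ok_fm \<mu> (SAtom r ts) = (\<forall>t\<in>set ts. ok_trm \<mu> t)"
| "ok_fm \<mu> SBot = True"
| "ok_fm \<mu> (SAnd A B) = (ok_fm \<mu> A \<and> ok_fm \<mu> B)"
| "ok_fm \<mu> (SOr A B) = (ok_fm \<mu> A \<and> ok_fm \<mu> B)"
| "ok_fm \<mu> (SImp A B) = (ok_fm \<mu> A \<and> ok_fm \<mu> B)"
| "ok_fm \<mu> (SAll x A) = (ok_var \<mu> x \<and> ok_fm \<mu> A)"
| "ok_fm \<mu> (SEx x A) = (ok_var \<mu> x \<and> ok_fm \<mu> A)"
| "ok_fm \<mu> (SSub x t A) = (ok_var \<mu> x \<and> ok_trm \<mu> t \<and> ok_fm \<mu> A \<and>
     free_for (i_trm \<mu> t) (i_var \<mu> x) (i_fm \<mu> A))"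

definition i_oty :: "minst \<Rightarrow> scheme \<Rightarrow> oty" where
  "i_oty \<mu> T = map_optype (i_var \<mu>) (i_fm \<mu>) (snd T)"

definition ok_inst :: "lang \<Rightarrow> minst \<Rightarrow> scheme \<Rightarrow> bool" where
  "ok_inst L \<mu> T \<longleftrightarrow>
     (length (mfms \<mu>), length (mvars \<mu>), length (mtrms \<mu>)) = fst T \<and>
     (\<forall>A\<in>set (mfms \<mu>). wf_fm L A) \<and> (\<forall>t\<in>set (mtrms \<mu>). wf_trm L t) \<and>
     (\<forall>x\<in>set1_optype (snd T). ok_var \<mu> x) \<and> (\<forall>A\<in>set2_optype (snd T). ok_fm \<mu> A)"

text \<open>
  Instances of schematic equations: the equations get the individual variables \<open>ys\<close> of the type as
  first arguments, and metavariables are replaced by expressions for their values.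
\<close>

definition i_meta :: "nat list \<Rightarrow> minst \<Rightarrow> meta \<Rightarrow> exp" where
  "i_meta ys \<mu> m =
     (case m of
        MFm j \<Rightarrow> if j < length (mfms \<mu>) then x_fm (set ys) (mfms \<mu> ! j) else EMeta m
      | MVar j \<Rightarrow> if j < length (mvars \<mu>) then EVal (q_nat (mvars \<mu> ! j)) else EMeta m
      | MTrm j \<Rightarrow> if j < length (mtrms \<mu>) then x_trm (set ys) (mtrms \<mu> ! j) else EMeta m)"

fun i_exp :: "(meta \<Rightarrow> exp) \<Rightarrow> exp \<Rightarrow> exp" where
  "i_exp s (EVar x) = EVar x"
| "i_exp s (EMeta m) = s m"
| "i_exp s (EVal v) = EVal v"
| "i_exp s (ECon c es) = ECon c (map (i_exp s) es)"
| "i_exp s (EFun f eqs) = EFun f (map (\<lambda>(ps, e). (ps, i_exp s e)) eqs)"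
| "i_exp s (EApp e es) = EApp (i_exp s e) (map (i_exp s) es)"

definition i_eqns :: "nat list \<Rightarrow> minst \<Rightarrow> eqns \<Rightarrow> eqns" where
  "i_eqns ys \<mu> = map (\<lambda>(ps, e). (map (PVar \<circ> IV) ys @ ps, i_exp (i_meta ys \<mu>) e))"


section \<open>Languages of grounding\<close>

text \<open>
  Operational symbols with the data that determine their operational type. \<open>NonPrim n \<mu>\<close> is the
  symbol with label \<open>n\<close> whose type is the instance given by \<open>\<mu>\<close> of the scheme of types of \<open>n\<close>
  (a single type is a scheme without metavariables).
\<close>

datatype sym =
    SymAndI fm fm
  | SymOrI1 fm fm
  | SymOrI2 fm fm
  | SymImpI fm fm
  | SymExI nat trm fm
  | SymAllI nat fm
  | SymBot fm
  | NonPrim nat minst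

fun sym_type :: "(nat \<Rightarrow> scheme) \<Rightarrow> sym \<Rightarrow> oty" where
  "sym_type sch (SymAndI A B) = OpT [Entry [] [] A, Entry [] [] B] (And A B)"
| "sym_type sch (SymOrI1 A B) = OpT [Entry [] [] A] (Or A B)"
| "sym_type sch (SymOrI2 A B) = OpT [Entry [] [] B] (Or A B)"
| "sym_type sch (SymImpI A B) = OpT [Entry [] [A] B] (Imp A B)"
| "sym_type sch (SymExI x t A) = OpT [Entry [] [] (subst x t A)] (Ex x A)"
| "sym_type sch (SymAllI x A) = OpT [Entry [x] [] A] (All x A)"
| "sym_type sch (SymBot A) = OpT [Entry [] [] Bot] A"
| "sym_type sch (NonPrim n \<mu>) = i_oty \<mu> (sch n)"

text \<open>The terms \<open>t\<close> displayed as in \<open>\<alpha>(t)\<close> count as part of the type, also when they occur in it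
  only vacuously.\<close>

fun sym_trms :: "sym \<Rightarrow> trm list" where
  "sym_trms (SymExI x t A) = [t]"
| "sym_trms (NonPrim n \<mu>) = mtrms \<mu>"
| "sym_trms _ = []"

definition fv_sym :: "(nat \<Rightarrow> scheme) \<Rightarrow> sym \<Rightarrow> nat set" where
  "fv_sym sch s = fv_oty (sym_type sch s) \<union> (\<Union>t\<in>set (sym_trms s). fv_trm t)"

definition sym_vars :: "(nat \<Rightarrow> scheme) \<Rightarrow> sym \<Rightarrow> nat list" where
  "sym_vars sch s = sorted_list_of_set (fv_sym sch s)"

fun wf_sym :: "lang \<Rightarrow> (nat \<Rightarrow> scheme) \<Rightarrow> sym \<Rightarrow> bool" where
  "wf_sym L sch (SymExI x t A) \<longleftrightarrow> wf_fm L A \<and> wf_trm L t \<and> free_for t x A"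
| "wf_sym L sch (NonPrim n \<mu>) \<longleftrightarrow> ok_inst L \<mu> (sch n) \<and> wf_oty L (i_oty \<mu> (sch n))"
| "wf_sym L sch s \<longleftrightarrow> wf_oty L (sym_type sch s)"

text \<open>\<open>deltas\<close> gives the derivations named by the individual constants \<open>\<delta>\<^sub>i\<close>.\<close>

record glang =
  deltas :: "nat \<Rightarrow> deriv option"
  syms :: "sym set"
  schemes :: "nat \<Rightarrow> scheme"

text \<open>There is no ground for \<open>\<bottom>\<close>; derivations of \<open>\<bottom>\<close>, if the atomic system is inconsistent, are
  accordingly not named.\<close>

definition grounding_language :: "'d base \<Rightarrow> glang \<Rightarrow> bool" where
  "grounding_language B \<Lambda> \<longleftrightarrow>
     (\<forall>D. (\<exists>i. deltas \<Lambda> i = Some D) \<longleftrightarrow> derivation (bsys B) D \<and> concl D \<noteq> Bot) \<and>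
     (\<forall>s\<in>syms \<Lambda>. wf_sym (blang B) (schemes \<Lambda>) s \<and>
        (\<exists>f. operation B (sym_vars (schemes \<Lambda>) s) (sym_type (schemes \<Lambda>) s) f)) \<and>
     (\<forall>T. finite {n. \<exists>\<mu>. NonPrim n \<mu> \<in> syms \<Lambda> \<and> schemes \<Lambda> n = T})"

text \<open>\<open>TOp s \<xi>ss Us\<close> applies \<open>s\<close> to \<open>Us\<close> and binds on the \<open>i\<close>-th entry the typed variables \<open>\<xi>ss ! i\<close>,
  besides the individual variables that are bound there according to the type of \<open>s\<close>.\<close>

datatype tm = TDelta nat | TVar tvar | TOp sym "tvar list list" "tm list"

text \<open>The free variables of the formulas to which variables and symbols are attached are free
  individual variables of the term.\<close>

fun FVI :: "glang \<Rightarrow> tm \<Rightarrow> nat set" where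
  "FVI \<Lambda> (TDelta i) = {}"
| "FVI \<Lambda> (TVar \<xi>) = fv (snd \<xi>)"
| "FVI \<Lambda> (TOp s \<xi>ss Us) = fv_sym (schemes \<Lambda>) s \<union>
     (\<Union>(e, X)\<in>set (zip (entries (sym_type (schemes \<Lambda>) s)) (map (FVI \<Lambda>) Us)). X - set (ebind e))"

fun FVT :: "tm \<Rightarrow> tvar set" where
  "FVT (TDelta i) = {}"
| "FVT (TVar \<xi>) = {\<xi>}"
| "FVT (TOp s \<xi>ss Us) = (\<Union>(\<xi>s, X)\<in>set (zip \<xi>ss (map FVT Us)). X - set \<xi>s)"

inductive has_type :: "'d base \<Rightarrow> glang \<Rightarrow> tm \<Rightarrow> fm \<Rightarrow> bool" for B \<Lambda> where
  "deltas \<Lambda> i = Some D \<Longrightarrow> has_type B \<Lambda> (TDelta i) (concl D)"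
| "wf_fm (blang B) A \<Longrightarrow> has_type B \<Lambda> (TVar (i, A)) A"
| "s \<in> syms \<Lambda> \<Longrightarrow> es = entries (sym_type (schemes \<Lambda>) s) \<Longrightarrow>
   length \<xi>ss = length es \<Longrightarrow> length Us = length es \<Longrightarrow>
   (\<forall>i<length es. has_type B \<Lambda> (Us ! i) (econ (es ! i)) \<and>
      distinct (\<xi>ss ! i) \<and> map snd (\<xi>ss ! i) = edis (es ! i) \<and>
      (\<forall>\<xi>\<in>FVT (Us ! i) - set (\<xi>ss ! i). fv (snd \<xi>) \<inter> set (ebind (es ! i)) = {})) \<Longrightarrow>
   has_type B \<Lambda> (TOp s \<xi>ss Us) (codom (sym_type (schemes \<Lambda>) s))"


section \<open>Denotation\<close>

datatype alph = ADelta nat | AVar tvar | ASym sym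

text \<open>The identity operation of type \<open>\<alpha> \<rhd> \<alpha>\<close>\<close>

definition id_op :: "fm \<Rightarrow> val" where
  "id_op A = Clo [] (LV 0)
     [(map (PVar \<circ> IV) (sorted_list_of_set (fv A)) @ [PVar (LV 1)], EVar (LV 1))]"

text \<open>The primitive operations. \<open>\<bottom>\<^sub>\<alpha>\<close> has no defining equations, since its domain is empty.\<close>

definition prim_op1 :: "nat list \<Rightarrow> exp \<Rightarrow> val" where
  "prim_op1 ys e = Clo [] (LV 0) [(map (PVar \<circ> IV) ys @ [PVar (LV 1)], e)]"

definition prim_op2 :: "nat list \<Rightarrow> exp \<Rightarrow> val" where
  "prim_op2 ys e = Clo [] (LV 0) [(map (PVar \<circ> IV) ys @ [PVar (LV 1), PVar (LV 2)], e)]"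

fun prim_op :: "nat list \<Rightarrow> sym \<Rightarrow> val option" where
  "prim_op ys (SymAndI A B) = Some (prim_op2 ys (ECon CAndI [EVar (LV 1), EVar (LV 2)]))"
| "prim_op ys (SymOrI1 A B) =
     Some (prim_op1 ys (ECon COrI1 [x_fm (set ys) A, x_fm (set ys) B, EVar (LV 1)]))"
| "prim_op ys (SymOrI2 A B) =
     Some (prim_op1 ys (ECon COrI2 [x_fm (set ys) A, x_fm (set ys) B, EVar (LV 1)]))"
| "prim_op ys (SymImpI A B) = Some (prim_op1 ys (ECon CImpI [x_fm (set ys) A, EVar (LV 1)]))"
| "prim_op ys (SymExI x t A) = Some (prim_op1 ys (ECon CExI [x_trm (set ys) t, EVar (LV 1)]))"
| "prim_op ys (SymAllI x A) = Some (prim_op1 ys (ECon CAllI [EVar (LV 1)]))"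
| "prim_op ys (SymBot A) = Some (Clo [] (LV 0) [])"
| "prim_op ys (NonPrim n \<mu>) = None"

definition alphabet_denotation :: "'d base \<Rightarrow> glang \<Rightarrow> (alph \<Rightarrow> val) \<Rightarrow> bool" where
  "alphabet_denotation B \<Lambda> dstar \<longleftrightarrow>
     (\<forall>i D. deltas \<Lambda> i = Some D \<longrightarrow> dstar (ADelta i) = q_deriv D) \<and>
     (\<forall>i A. wf_fm (blang B) A \<longrightarrow> dstar (AVar (i, A)) = id_op A) \<and>
     (\<forall>s\<in>syms \<Lambda>. case prim_op (sym_vars (schemes \<Lambda>) s) s of
        Some f \<Rightarrow> dstar (ASym s) = f
      | None \<Rightarrow> operation B (sym_vars (schemes \<Lambda>) s) (sym_type (schemes \<Lambda>) s) (dstar (ASym s))) \<and>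
     (\<forall>n. \<exists>\<rho> f eqs. \<forall>\<mu>. NonPrim n \<mu> \<in> syms \<Lambda> \<longrightarrow>
        defined_by \<rho> f (i_eqns (sym_vars (schemes \<Lambda>) (NonPrim n \<mu>)) \<mu> eqs) (dstar (ASym (NonPrim n \<mu>))))"

text \<open>The expression defining the denotation of a term from the values of its free variables; on
  an entry, the denotation is abstracted with respect to the variables that are bound there.\<close>

fun den_exp :: "glang \<Rightarrow> (alph \<Rightarrow> val) \<Rightarrow> tm \<Rightarrow> exp" where
  "den_exp \<Lambda> dstar (TDelta i) = EVal (dstar (ADelta i))"
| "den_exp \<Lambda> dstar (TVar \<xi>) =
     EApp (EVal (dstar (AVar \<xi>)))
       (map (EVar \<circ> IV) (sorted_list_of_set (fv (snd \<xi>))) @ [EVar (TV \<xi>)])"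
| "den_exp \<Lambda> dstar (TOp s \<xi>ss Us) =
     EApp (EVal (dstar (ASym s)))
       (map (EVar \<circ> IV) (sym_vars (schemes \<Lambda>) s) @
        map (\<lambda>((en, \<xi>s), e). lam (map IV (ebind en) @ map TV \<xi>s) e)
          (zip (zip (entries (sym_type (schemes \<Lambda>) s)) \<xi>ss) (map (den_exp \<Lambda> dstar) Us)))"

text \<open>
  The denotation of a term whose free individual variables are listed by \<open>xs\<close>, whose free typed
  variables are listed by \<open>\<xi>s\<close>, and the types of whose free typed variables are listed by \<open>\<Gamma>\<close>: it
  has one argument for each element of \<open>xs\<close> and of \<open>\<Gamma>\<close>, the latter being the common value of
  all variables in \<open>\<xi>s\<close> of that type. For a closed term it is the value itself.
\<close>

definition den ::
  "glang \<Rightarrow> (alph \<Rightarrow> val) \<Rightarrow> nat list \<Rightarrow> tvar list \<Rightarrow> fm list \<Rightarrow> tm \<Rightarrow> val" where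
  "den \<Lambda> dstar xs \<xi>s \<Gamma> U =
     (THE v. eval []
        (lam (map IV xs @ map FV \<Gamma>)
           (EApp (lam (map TV \<xi>s) (den_exp \<Lambda> dstar U)) (map (EVar \<circ> FV \<circ> snd) \<xi>s))) v)"

end

theory Submission
  imports Defs
begin

text \<open>
  The theorem is a soundness statement: in every environment that assigns individuals to the free
  individual variables of a typed term and grounds for the correspondingly instantiated types to its
  free typed variables, the defining expression of the term has a value, and this value is a ground
  for the instantiated type of the term. This is proved by induction on the typing of the term. On
  an entry with bound variables, the induction hypothesis for all extensions of the environment says
  that the abstracted expression is an admissible argument. The eigenvariable restriction is what
  keeps the grounds assigned to the other typed variables correct in the extended environment.
\<close>

section \<open>Substitution\<close>

lemma sub_trm_cong: "(\<And>x. x \<in> fv_trm t \<Longrightarrow> \<sigma> x = \<tau> x) \<Longrightarrow> sub_trm \<sigma> t = sub_trm \<tau> t"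
  by (cases t) auto

lemma sub_cong: "(\<And>x. x \<in> fv A \<Longrightarrow> \<sigma> x = \<tau> x) \<Longrightarrow> sub \<sigma> A = sub \<tau> A"
proof (induction A arbitrary: \<sigma> \<tau>)
  case (Atom r ts)
  then show ?case by (auto intro!: sub_trm_cong)
next
  case (And A1 A2)
  show ?case using And.prems by (auto intro!: And.IH)
next
  case (Or A1 A2)
  show ?case using Or.prems by (auto intro!: Or.IH)
next
  case (Imp A1 A2)
  show ?case using Imp.prems by (auto intro!: Imp.IH)
next
  case (All y A)
  show ?case using All.prems by (auto intro!: All.IH)
next
  case (Ex y A)
  show ?case using Ex.prems by (auto intro!: Ex.IH)
qed simp

lemma sub_trm_Var: "sub_trm Var t = t"
  by (cases t) auto

lemma sub_Var: "sub Var A = A"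
  by (induction A) (auto simp: sub_trm_Var map_idI)

lemma sub_closed: "fv A = {} \<Longrightarrow> sub \<sigma> A = A"
  using sub_cong[of A \<sigma> Var] by (simp add: sub_Var)

lemma sub_trm_sub_trm: "sub_trm \<tau> (sub_trm \<sigma> t) = sub_trm (\<lambda>y. sub_trm \<tau> (\<sigma> y)) t"
  by (cases t) auto

text \<open>No variable is captured if \<open>\<sigma>\<close> only replaces variables by closed terms.\<close>

lemma sub_sub:
  "(\<And>y. \<sigma> y = Var y \<or> fv_trm (\<sigma> y) = {}) \<Longrightarrow> sub \<tau> (sub \<sigma> A) = sub (\<lambda>y. sub_trm \<tau> (\<sigma> y)) A"
proof (induction A arbitrary: \<sigma> \<tau>)
  case (Atom r ts)
  then show ?case by (simp add: sub_trm_sub_trm)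
next
  case (All z A)
  \<comment> \<open>For \<open>y \<noteq> z\<close> the value \<open>\<sigma> y\<close> is
    \<open>Var y\<close> or closed, so it does not contain \<open>z\<close> and is insensitive to
    resetting \<open>\<tau>\<close> at \<open>z\<close>.\<close>
  have "(\<lambda>y. sub_trm (\<tau>(z := Var z)) ((\<sigma>(z := Var z)) y)) = (\<lambda>y. sub_trm \<tau> (\<sigma> y))(z := Var z)"
  proof
    fix y
    show "sub_trm (\<tau>(z := Var z)) ((\<sigma>(z := Var z)) y) = ((\<lambda>y. sub_trm \<tau> (\<sigma> y))(z := Var z)) y"
      using All.prems[of y] by (auto intro: sub_trm_cong)
  qed
  moreover have "sub (\<tau>(z := Var z)) (sub (\<sigma>(z := Var z)) A) =
      sub (\<lambda>y. sub_trm (\<tau>(z := Var z)) ((\<sigma>(z := Var z)) y)) A"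
    using All.prems by (intro All.IH) auto
  ultimately show ?case by simp
next
  case (Ex z A)
  have "(\<lambda>y. sub_trm (\<tau>(z := Var z)) ((\<sigma>(z := Var z)) y)) = (\<lambda>y. sub_trm \<tau> (\<sigma> y))(z := Var z)"
  proof
    fix y
    show "sub_trm (\<tau>(z := Var z)) ((\<sigma>(z := Var z)) y) = ((\<lambda>y. sub_trm \<tau> (\<sigma> y))(z := Var z)) y"
      using Ex.prems[of y] by (auto intro: sub_trm_cong)
  qed
  moreover have "sub (\<tau>(z := Var z)) (sub (\<sigma>(z := Var z)) A) =
      sub (\<lambda>y. sub_trm (\<tau>(z := Var z)) ((\<sigma>(z := Var z)) y)) A"
    using Ex.prems by (intro Ex.IH) auto
  ultimately show ?case by simp
qed auto

text \<open>At variables other than \<open>x\<close> the values of \<open>\<sigma>\<close> do not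
  contain \<open>x\<close>, so the second substitution acts at \<open>x\<close> alone. The
  quantifier clauses of \<open>ground\<close> substitute into a body already instantiated with
  \<open>x\<close> reset; here the two substitutions become one.\<close>

lemma subst_closed_sub:
  assumes "\<And>y. \<sigma> y = Var y \<or> fv_trm (\<sigma> y) = {}"
  shows "subst x t (sub (\<sigma>(x := Var x)) A) = sub (\<sigma>(x := t)) A"
proof -
  have "(\<lambda>y. sub_trm (Var(x := t)) ((\<sigma>(x := Var x)) y)) = \<sigma>(x := t)"
  proof
    show "sub_trm (Var(x := t)) ((\<sigma>(x := Var x)) y) = (\<sigma>(x := t)) y" for y
      using assms[of y] sub_trm_cong[of "\<sigma> y" "Var(x := t)" Var] by (auto simp: sub_trm_Var)
  qed
  moreover have "sub (Var(x := t)) (sub (\<sigma>(x := Var x)) A) =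
      sub (\<lambda>y. sub_trm (Var(x := t)) ((\<sigma>(x := Var x)) y)) A"
    using assms by (intro sub_sub) auto
  ultimately show ?thesis by (simp add: subst_def)
qed

text \<open>\<open>free_for\<close> keeps the variables of \<open>t\<close> out of the scope of
  quantifiers that bind them. \<open>\<sigma>\<close> can be arbitrary, since capture by its values
  would occur alike on both sides.\<close>

lemma sub_subst: "free_for t x A \<Longrightarrow> sub \<sigma> (subst x t A) = sub (\<sigma>(x := sub_trm \<sigma> t)) A"
proof (induction A arbitrary: \<sigma>)
  case (Atom r ts)
  have "(\<lambda>y. sub_trm \<sigma> ((Var(x := t)) y)) = \<sigma>(x := sub_trm \<sigma> t)" by auto
  then show ?case by (simp add: subst_def sub_trm_sub_trm del: fun_upd_apply)
next
  case (All z A)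
  show ?case
  proof (cases "x \<in> fv (All z A)")
    \<comment> \<open>A quantified formula without free \<open>x\<close> satisfies
      \<open>free_for\<close> outright; neither side then depends on the value at
      \<open>x\<close>.\<close>
    case False
    then have "sub (Var(x := t)) (All z A) = sub Var (All z A)" by (intro sub_cong) auto
    then have "subst x t (All z A) = All z A" by (simp only: subst_def sub_Var)
    moreover have "sub \<sigma> (All z A) = sub (\<sigma>(x := sub_trm \<sigma> t)) (All z A)"
      using False by (intro sub_cong) auto
    ultimately show ?thesis by (simp only:)
  next
    case True
    with All.prems have z: "x \<noteq> z" "z \<notin> fv_trm t" "free_for t x A" by auto
    have "(Var(x := t))(z := Var z) = Var(x := t)" using z by auto
    moreover have "sub_trm (\<sigma>(z := Var z)) t = sub_trm \<sigma> t" using z by (intro sub_trm_cong) auto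
    ultimately show ?thesis
      using All.IH[OF z(3), of "\<sigma>(z := Var z)"] z(1)
      by (simp add: subst_def fun_upd_twist del: fun_upd_apply)
  qed
next
  case (Ex z A)
  show ?case
  proof (cases "x \<in> fv (Ex z A)")
    case False
    then have "sub (Var(x := t)) (Ex z A) = sub Var (Ex z A)" by (intro sub_cong) auto
    then have "subst x t (Ex z A) = Ex z A" by (simp only: subst_def sub_Var)
    moreover have "sub \<sigma> (Ex z A) = sub (\<sigma>(x := sub_trm \<sigma> t)) (Ex z A)"
      using False by (intro sub_cong) auto
    ultimately show ?thesis by (simp only:)
  next
    case True
    with Ex.prems have z: "x \<noteq> z" "z \<notin> fv_trm t" "free_for t x A" by auto
    have "(Var(x := t))(z := Var z) = Var(x := t)" using z by auto
    moreover have "sub_trm (\<sigma>(z := Var z)) t = sub_trm \<sigma> t" using z by (intro sub_trm_cong) auto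
    ultimately show ?thesis
      using Ex.IH[OF z(3), of "\<sigma>(z := Var z)"] z(1)
      by (simp add: subst_def fun_upd_twist del: fun_upd_apply)
  qed
qed (auto simp: subst_def)

section \<open>Instantiation of variables by names of individuals\<close>

lemma map_of_zip_map:
  "inj f \<Longrightarrow> map_of (zip (map f xs) (map g ys)) (f x) = map_option g (map_of (zip xs ys) x)"
  by (induction xs ys rule: list_induct2') (auto dest: injD)

lemma bnd_map: "x \<in> set xs \<Longrightarrow> bnd B xs (map d xs) \<sigma> x = Cst (bname B (d x))"
proof -
  assume "x \<in> set xs"
  then have "map_of (zip xs (map d xs)) x = Some (d x)" by (induction xs) auto
  then show ?thesis by (simp add: bnd_def)
qed

lemma bnd_notin: "x \<notin> set xs \<Longrightarrow> bnd B xs ds \<sigma> x = \<sigma> x"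
  by (auto simp: bnd_def split: option.split dest!: map_of_SomeD set_zip_leftD)

lemma bnd_in:
  assumes "x \<in> set xs" "length ds = length xs" "set ds \<subseteq> bdom B"
  obtains d where "d \<in> bdom B" "map_of (zip xs ds) x = Some d" "bnd B xs ds \<sigma> x = Cst (bname B d)"
proof -
  obtain d where d: "map_of (zip xs ds) x = Some d"
    using assms(1,2) by (metis map_of_zip_is_Some)
  then have "d \<in> set ds" by (meson map_of_SomeD set_zip_rightD)
  with d assms(3) show ?thesis by (intro that[of d]) (auto simp: bnd_def)
qed

lemma bnd_Var: "bnd B xs ds Var y = Var y \<or> fv_trm (bnd B xs ds Var y) = {}"
  by (auto simp: bnd_def split: option.split)

lemma bnd_Nil [simp]: "bnd B [] ds \<sigma> = \<sigma>"
  by (auto simp: bnd_def)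

section \<open>Evaluation\<close>

lemma matches_PVar: "length vs = length xs \<Longrightarrow> matches (map PVar xs) vs = Some (zip xs vs)"
  by (induction vs xs rule: list_induct2) auto

text \<open>Variable patterns match every argument. The list \<open>xs\<close> is nonempty because
  application to no arguments does not run the body: \<open>app_Nil\<close> returns the closure
  itself.\<close>

lemma app_Clo_PVar:
  assumes "xs \<noteq> []" "length vs = length xs"
    and "eval (zip xs vs @ (f, Clo \<rho> f [(map PVar xs, e)]) # \<rho>) e v"
  shows "app (Clo \<rho> f [(map PVar xs, e)]) vs v"
  using assms by (intro app_Clo[of vs _ "zip xs vs" e]) (auto simp: matches_PVar)

text \<open>\<open>\<rho>'\<close> may differ from \<open>\<rho>\<close> at \<open>LV 0\<close>, the name under which \<open>lam\<close> introduces the function.\<close>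

lemma eval_lam:
  assumes "xs = [] \<Longrightarrow> \<exists>v. eval \<rho> e v"
  obtains u \<rho>' where "eval \<rho> (lam xs e) u" "\<And>y. y \<noteq> LV 0 \<Longrightarrow> map_of \<rho>' y = map_of \<rho> y"
    "\<And>vs v. length vs = length xs \<Longrightarrow> eval (zip xs vs @ \<rho>') e v \<Longrightarrow> app u vs v"
proof (cases "xs = []")
  \<comment> \<open>Without parameters \<open>lam\<close> is the expression itself, so that
    expression must have a value of its own; determinacy identifies any value found for
    \<open>e\<close> with it.\<close>
  case True
  with assms obtain u where u: "eval \<rho> e u" by auto
  show ?thesis
  proof (rule that[of u \<rho>])
    show "app u vs v" if "length vs = length xs" "eval (zip xs vs @ \<rho>) e v" for vs v
      using that True eval_det[OF u, of v] app_Nil by auto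
  qed (use u True in \<open>auto simp: lam_def\<close>)
next
  case False
  let ?u = "Clo \<rho> (LV 0) [(map PVar xs, e)]"
  show ?thesis
  proof (rule that[of ?u "(LV 0, ?u) # \<rho>"])
    show "eval \<rho> (lam xs e) ?u" using False eval_EFun by (simp add: lam_def)
  qed (use False in \<open>auto intro: app_Clo_PVar\<close>)
qed

section \<open>Evaluation of codes of instantiated terms and formulas\<close>

lemma eval_x_trm:
  assumes "\<And>y. y \<in> V \<Longrightarrow> \<exists>c. \<sigma> y = Cst c \<and> map_of \<rho> (IV y) = Some (q_trm (Cst c))"
    and "\<And>y. y \<notin> V \<Longrightarrow> \<sigma> y = Var y"
  shows "eval \<rho> (x_trm V t) (q_trm (sub_trm \<sigma> t))"
proof (cases t)
  case (Var y)
  then show ?thesis using assms[of y] eval_EVal[of \<rho> "q_trm (Var y)"]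
    by (auto simp del: q_trm.simps intro!: eval_EVar)
next
  case (Cst c)
  then show ?thesis using eval_EVal[of \<rho> "q_trm (Cst c)"] by simp
qed

lemma eval_x_list:
  "(\<And>a. a \<in> set as \<Longrightarrow> eval \<rho> (x a) (q (h a))) \<Longrightarrow> eval \<rho> (x_list x as) (q_list q (map h as))"
  by (induction as) (auto intro!: eval_ECon)

text \<open>The hypotheses tie \<open>\<sigma>\<close> to \<open>\<rho>\<close> on \<open>V\<close>
  and make it the identity elsewhere. They survive a quantifier because \<open>x_fm\<close> drops
  \<open>x\<close> from \<open>V\<close> exactly where \<open>sub\<close> resets
  \<open>\<sigma>\<close> at \<open>x\<close>.\<close>

lemma eval_x_fm:
  assumes "\<And>y. y \<in> V \<Longrightarrow> \<exists>c. \<sigma> y = Cst c \<and> map_of \<rho> (IV y) = Some (q_trm (Cst c))"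
    and "\<And>y. y \<notin> V \<Longrightarrow> \<sigma> y = Var y"
  shows "eval \<rho> (x_fm V A) (q_fm (sub \<sigma> A))"
  using assms
proof (induction A arbitrary: V \<sigma>)
  case (Atom r ts)
  have "eval \<rho> (x_list (x_trm V) ts) (q_list q_trm (map (sub_trm \<sigma>) ts))"
    by (intro eval_x_list eval_x_trm Atom)
  then show ?case by (auto intro!: eval_ECon eval_EVal)
next
  case (And A1 A2)
  show ?case using And.IH[OF And.prems] by (auto intro!: eval_ECon)
next
  case (Or A1 A2)
  show ?case using Or.IH[OF Or.prems] by (auto intro!: eval_ECon)
next
  case (Imp A1 A2)
  show ?case using Imp.IH[OF Imp.prems] by (auto intro!: eval_ECon)
next
  case (All x A)
  have "eval \<rho> (x_fm (V - {x}) A) (q_fm (sub (\<sigma>(x := Var x)) A))"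
    using All.prems by (intro All.IH) auto
  then show ?case by (auto intro!: eval_ECon eval_EVal)
next
  case (Ex x A)
  have "eval \<rho> (x_fm (V - {x}) A) (q_fm (sub (\<sigma>(x := Var x)) A))"
    using Ex.prems by (intro Ex.IH) auto
  then show ?case by (auto intro!: eval_ECon eval_EVal)
qed (auto intro!: eval_ECon)

section \<open>Operations\<close>

text \<open>\<open>app_Nil\<close> gives \<open>g\<close> itself as the value on no arguments, and
  \<open>app_det\<close> excludes any other.\<close>

lemma entry_arg_Nil [simp]: "entry_arg B \<sigma> (Entry [] [] A) g \<longleftrightarrow> ground B (sub \<sigma> A) g"
  by (auto simp: entry_arg_def intro: app_Nil dest: app_det[OF app_Nil])

text \<open>The individuals \<open>ds\<close> overwrite the bound variables, and all other variables
  of the discharged formulas and of the conclusion lie in \<open>fv_entry e\<close>.\<close>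

lemma entry_arg_cong:
  assumes "\<And>x. x \<in> fv_entry e \<Longrightarrow> \<sigma> x = \<tau> x" "entry_arg B \<sigma> e f"
  shows "entry_arg B \<tau> e f"
  unfolding entry_arg_def
proof (intro allI impI, elim conjE)
  fix ds gs
  assume len: "length ds = length (ebind e)" and ds: "set ds \<subseteq> bdom B"
    and gs: "list_all2 (\<lambda>A. ground B (sub (bnd B (ebind e) ds \<tau>) A)) (edis e) gs"
  have eq: "sub (bnd B (ebind e) ds \<sigma>) A = sub (bnd B (ebind e) ds \<tau>) A"
    if "A \<in> insert (econ e) (set (edis e))" for A
  proof (rule sub_cong)
    fix x assume x: "x \<in> fv A"
    show "bnd B (ebind e) ds \<sigma> x = bnd B (ebind e) ds \<tau> x"
    proof (cases "x \<in> set (ebind e)")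
      case True
      then show ?thesis by (elim bnd_in[OF _ len ds, of _ \<sigma>]) (simp add: bnd_def)
    next
      case False
      then show ?thesis using that x assms(1)[of x] by (auto simp: bnd_notin fv_entry_def)
    qed
  qed
  have "list_all2 (\<lambda>A. ground B (sub (bnd B (ebind e) ds \<sigma>) A)) (edis e) gs"
    using gs eq by (auto simp: list_all2_conv_all_nth)
  then show "\<exists>v. app f (map (ind B) ds @ gs) v \<and> ground B (sub (bnd B (ebind e) ds \<tau>) (econ e)) v"
    using assms(2) len ds eq[of "econ e"] unfolding entry_arg_def by fastforce
qed

text \<open>\<open>operation\<close> speaks of substitutions that are the identity outside
  \<open>ys\<close>, whereas a \<open>\<sigma>\<close> met under binders may have values elsewhere
  too. The two agree on \<open>ys\<close>, which contains all variables of
  \<open>\<tau>\<close>.\<close>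

lemma operation_app:
  assumes op: "operation B ys \<tau> f"
    and d: "\<And>y. y \<in> set ys \<Longrightarrow> d y \<in> bdom B \<and> \<sigma> y = Cst (bname B (d y))"
    and as: "list_all2 (entry_arg B \<sigma>) (entries \<tau>) as"
  shows "\<exists>v. app f (map (\<lambda>y. ind B (d y)) ys @ as) v \<and> ground B (sub \<sigma> (codom \<tau>)) v"
proof -
  let ?\<sigma> = "bnd B ys (map d ys) Var"
  have eq: "\<sigma> y = ?\<sigma> y" if "y \<in> set ys" for y
    using that d by (simp add: bnd_map)
  have fv: "fv_oty \<tau> \<subseteq> set ys" using op by (simp add: operation_def)
  have "list_all2 (entry_arg B ?\<sigma>) (entries \<tau>) as"
  proof -
    have "entry_arg B ?\<sigma> e a" if "e \<in> set (entries \<tau>)" "entry_arg B \<sigma> e a" for e a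
      by (rule entry_arg_cong[OF _ that(2)]) (use that(1) fv eq in \<open>auto simp: fv_oty_def\<close>)
    with as show ?thesis by (auto simp: list_all2_conv_all_nth)
  qed
  with op d obtain v where "app f (map (ind B) (map d ys) @ as) v" "ground B (sub ?\<sigma> (codom \<tau>)) v"
    unfolding operation_def by (metis (no_types, lifting) image_subset_iff length_map set_map)
  moreover have "sub ?\<sigma> (codom \<tau>) = sub \<sigma> (codom \<tau>)"
    using eq fv by (intro sub_cong) (auto simp: fv_oty_def)
  ultimately show ?thesis by (auto simp: o_def)
qed

section \<open>Finite sets of variables and valuations by environments\<close>

lemma finite_fv: "finite (fv A)"
proof (induction A)
  case (Atom r ts)
  have "finite (fv_trm t)" for t by (cases t) auto
  then show ?case by simp
qed auto

lemma finite_fv_sym: "finite (fv_sym sch s)"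
proof -
  have "finite (fv_trm t)" for t by (cases t) auto
  then show ?thesis by (auto simp: fv_sym_def fv_oty_def fv_entry_def finite_fv)
qed

lemma set_sym_vars: "set (sym_vars sch s) = fv_sym sch s"
  by (simp add: sym_vars_def finite_fv_sym)

text \<open>An individual enters twice: by its name in formulas, through \<open>\<sigma>\<close>,
  and as a coded argument of programs, through \<open>\<rho>\<close>. One witness \<open>d\<close>
  keeps the two in step.\<close>

definition ivals :: "'d base \<Rightarrow> nat set \<Rightarrow> env \<Rightarrow> (nat \<Rightarrow> trm) \<Rightarrow> bool" where
  "ivals B V \<rho> \<sigma> \<longleftrightarrow>
     (\<forall>y\<in>V. \<exists>d\<in>bdom B. \<sigma> y = Cst (bname B d) \<and> map_of \<rho> (IV y) = Some (ind B d))"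

definition tvals :: "'d base \<Rightarrow> tvar set \<Rightarrow> env \<Rightarrow> (nat \<Rightarrow> trm) \<Rightarrow> bool" where
  "tvals B W \<rho> \<sigma> \<longleftrightarrow> (\<forall>\<xi>\<in>W. \<exists>g. map_of \<rho> (TV \<xi>) = Some g \<and> ground B (sub \<sigma> (snd \<xi>)) g)"

lemma map_of_zip_notin: "z \<notin> set xs \<Longrightarrow> map_of (zip xs vs) z = None"
  by (auto simp: map_of_eq_None_iff dest: set_zip_leftD)

text \<open>The constructor \<open>IV\<close> separates the individual block from \<open>zs\<close>,
  which may hold typed variables, argument places or local names. A variable outside
  \<open>xs\<close> thus falls through both blocks to \<open>\<rho>\<close>.\<close>

lemma ivals_bind:
  assumes "length ds = length xs" "set ds \<subseteq> bdom B" "ivals B (V - set xs) \<rho> \<sigma>"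
    and "\<And>y. y \<in> V \<Longrightarrow> IV y \<notin> set zs"
  shows "ivals B V (zip (map IV xs @ zs) (map (ind B) ds @ vs) @ \<rho>) (bnd B xs ds \<sigma>)"
  unfolding ivals_def
proof
  fix y assume y: "y \<in> V"
  have eq: "map_of (zip (map IV xs) (map (ind B) ds)) (IV y) = map_option (ind B) (map_of (zip xs ds) y)"
    by (intro map_of_zip_map injI) simp
  show "\<exists>d\<in>bdom B. bnd B xs ds \<sigma> y = Cst (bname B d) \<and>
      map_of (zip (map IV xs @ zs) (map (ind B) ds @ vs) @ \<rho>) (IV y) = Some (ind B d)"
  proof (cases "y \<in> set xs")
    case True
    from bnd_in[OF True assms(1,2), of \<sigma>] obtain d where
      "d \<in> bdom B" "map_of (zip xs ds) y = Some d" "bnd B xs ds \<sigma> y = Cst (bname B d)" .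
    then show ?thesis using assms(1) by (auto simp: eq map_add_def simp del: map_of_zip_is_None)
  next
    case False
    then have "map_of (zip xs ds) y = None" "map_of (zip zs vs) (IV y) = None"
      using assms(4)[OF y] by (simp_all add: map_of_zip_notin)
    then show ?thesis using assms(1,3) False y
      by (auto simp: eq bnd_notin ivals_def map_add_def simp del: map_of_zip_is_None)
  qed
qed

lemma tvals_bind:
  assumes "length ds = length xs" "length gs = length \<xi>s"
    and gs: "list_all2 (\<lambda>A. ground B (sub (bnd B xs ds \<sigma>) A)) (map snd \<xi>s) gs"
    and "tvals B (W - set \<xi>s) \<rho> \<sigma>" "\<And>\<xi>. \<xi> \<in> W - set \<xi>s \<Longrightarrow> fv (snd \<xi>) \<inter> set xs = {}"
  shows "tvals B W (zip (map IV xs @ map TV \<xi>s) (map (ind B) ds @ gs) @ \<rho>) (bnd B xs ds \<sigma>)"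
  unfolding tvals_def
proof
  fix \<xi> assume \<xi>: "\<xi> \<in> W"
  have eq: "map_of (zip (map TV \<xi>s) gs) (TV \<xi>) = map_of (zip \<xi>s gs) \<xi>"
    using map_of_zip_map[of TV \<xi>s id gs \<xi>] by (simp add: inj_def option.map_id)
  have "map_of (zip (map IV xs) (map (ind B) ds)) (TV \<xi>) = None"
    by (intro map_of_zip_notin) auto
  then have lookup: "map_of (zip (map IV xs @ map TV \<xi>s) (map (ind B) ds @ gs) @ \<rho>) (TV \<xi>) =
      (case map_of (zip \<xi>s gs) \<xi> of Some v \<Rightarrow> Some v | None \<Rightarrow> map_of \<rho> (TV \<xi>))"
    using assms(1) by (simp add: map_add_def eq del: map_of_zip_is_None split: option.split)
  show "\<exists>g. map_of (zip (map IV xs @ map TV \<xi>s) (map (ind B) ds @ gs) @ \<rho>) (TV \<xi>) = Some g \<and>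
      ground B (sub (bnd B xs ds \<sigma>) (snd \<xi>)) g"
  proof (cases "\<xi> \<in> set \<xi>s")
    case True
    then obtain g where g: "map_of (zip \<xi>s gs) \<xi> = Some g"
      using assms(2) by (metis map_of_zip_is_Some)
    then have "(\<xi>, g) \<in> set (zip \<xi>s gs)" by (rule map_of_SomeD)
    then have "ground B (sub (bnd B xs ds \<sigma>) (snd \<xi>)) g"
      using gs by (auto simp: list_all2_conv_all_nth in_set_zip)
    then show ?thesis using g lookup by simp
  next
    case False
    then have "map_of (zip \<xi>s gs) \<xi> = None" by (simp add: map_of_zip_notin)
    \<comment> \<open>Eigenvariable condition: the type of a variable not bound here contains none
      of \<open>xs\<close>, so its instance is unchanged and its old ground stays correct.\<close>
    moreover have "sub (bnd B xs ds \<sigma>) (snd \<xi>) = sub \<sigma> (snd \<xi>)"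
      using assms(5)[of \<xi>] \<xi> False by (intro sub_cong bnd_notin) auto
    ultimately show ?thesis using assms(4) \<xi> False lookup by (auto simp: tvals_def)
  qed
qed

text \<open>Variable patterns always match, so only the right-hand side needs checking, in
  environments holding the individuals and the arguments. \<open>zs\<close> is nonempty so that the
  closure is really applied even when \<open>ys\<close> is empty.\<close>

lemma operation_equation:
  assumes "distinct ys" "fv_oty \<tau> \<subseteq> set ys" "zs \<noteq> []" "length zs = length (entries \<tau>)"
    and "\<And>z. z \<in> set zs \<Longrightarrow> z \<notin> range IV"
    and "\<And>\<rho> \<sigma> as. ivals B (set ys) \<rho> \<sigma> \<Longrightarrow> (\<And>y. \<sigma> y = Var y \<or> fv_trm (\<sigma> y) = {}) \<Longrightarrow>
       (\<And>y. y \<notin> set ys \<Longrightarrow> \<sigma> y = Var y) \<Longrightarrow>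
       (\<And>z. z \<in> set zs \<Longrightarrow> map_of \<rho> z = map_of (zip zs as) z) \<Longrightarrow>
       list_all2 (entry_arg B \<sigma>) (entries \<tau>) as \<Longrightarrow>
       \<exists>v. eval \<rho> e v \<and> ground B (sub \<sigma> (codom \<tau>)) v"
  shows "operation B ys \<tau> (Clo [] f [(map (PVar \<circ> IV) ys @ map PVar zs, e)])"
  unfolding operation_def
proof (intro conjI allI impI, goal_cases)
  case (3 ds as)
  let ?xs = "map IV ys @ zs" and ?vs = "map (ind B) ds @ as"
  let ?u = "Clo [] f [(map PVar ?xs, e)]" and ?\<sigma> = "bnd B ys ds Var"
  let ?\<rho> = "zip ?xs ?vs @ [(f, ?u)]"
  from 3 assms(4) have len: "length ?vs = length ?xs" by (auto dest: list_all2_lengthD)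
  have "\<exists>v. eval ?\<rho> e v \<and> ground B (sub ?\<sigma> (codom \<tau>)) v"
  proof (rule assms(6))
    show "ivals B (set ys) ?\<rho> ?\<sigma>" using 3 assms(5) by (intro ivals_bind) (auto simp: ivals_def)
    show "map_of ?\<rho> z = map_of (zip zs as) z" if z: "z \<in> set zs" for z
    proof -
      have "map_of (zip (map IV ys) (map (ind B) ds)) z = None"
        using assms(5)[OF z] by (intro map_of_zip_notin) auto
      \<comment> \<open>Each place in \<open>zs\<close> is filled, so the lookup ends before the
        entry for \<open>f\<close>, whatever that name is.\<close>
      moreover obtain a where "map_of (zip zs as) z = Some a"
        using z 3 assms(4) by (metis list_all2_lengthD map_of_zip_is_Some)
      ultimately show ?thesis
        using 3 by (simp add: map_add_def del: map_of_zip_is_None)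
    qed
  qed (use 3 in \<open>simp_all add: bnd_Var bnd_notin\<close>)
  then show ?case using app_Clo_PVar[OF _ len, of f "[]" e] assms(3) by auto
qed (use assms in auto)

section \<open>The primitive operations\<close>

lemma sub_bnd_single:
  assumes "\<And>y. \<sigma> y = Var y \<or> fv_trm (\<sigma> y) = {}"
  shows "sub (bnd B [x] [d] \<sigma>) A = subst x (Cst (bname B d)) (sub (\<sigma>(x := Var x)) A)"
proof -
  have "bnd B [x] [d] \<sigma> = \<sigma>(x := Cst (bname B d))" by (auto simp: bnd_def)
  then show ?thesis by (simp add: subst_closed_sub[OF assms])
qed

text \<open>Each primitive operation returns a value of the form that \<open>ground\<close> demands
  for its codomain, its labels being computed by \<open>x_fm\<close> and \<open>x_trm\<close> as
  codes of the current instances.\<close>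

lemma prim_op_operation:
  assumes base: "atomic_base B" and wf: "wf_sym (blang B) sch s"
    and op: "prim_op (sym_vars sch s) s = Some f"
  shows "operation B (sym_vars sch s) (sym_type sch s) f"
proof -
  let ?ys = "sym_vars sch s"
  have ys: "distinct ?ys" "fv_oty (sym_type sch s) \<subseteq> set ?ys"
    using finite_fv_sym[of sch s] by (auto simp: sym_vars_def fv_sym_def)
  have xfm: "eval \<rho> (x_fm (set ?ys) A) (q_fm (sub \<sigma> A))"
    and xtrm: "eval \<rho> (x_trm (set ?ys) t) (q_trm (sub_trm \<sigma> t))"
    if "ivals B (set ?ys) \<rho> \<sigma>" "\<And>y. y \<notin> set ?ys \<Longrightarrow> \<sigma> y = Var y" for \<rho> \<sigma> A t
    using that by (auto simp: ivals_def ind_def intro!: eval_x_fm eval_x_trm)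
  \<comment> \<open>Common frame for disjunction, implication and the quantifiers: the single
    argument is reached as the value of \<open>LV 1\<close>.\<close>
  have op1: "operation B ?ys (sym_type sch s) (prim_op1 ?ys e)"
    if en: "entries (sym_type sch s) = [en]"
      and step: "\<And>\<rho> \<sigma> g. ivals B (set ?ys) \<rho> \<sigma> \<Longrightarrow> (\<And>y. \<sigma> y = Var y \<or> fv_trm (\<sigma> y) = {}) \<Longrightarrow>
        (\<And>y. y \<notin> set ?ys \<Longrightarrow> \<sigma> y = Var y) \<Longrightarrow> eval \<rho> (EVar (LV 1)) g \<Longrightarrow> entry_arg B \<sigma> en g \<Longrightarrow>
        \<exists>v. eval \<rho> e v \<and> ground B (sub \<sigma> (codom (sym_type sch s))) v"
    for e en
  proof -
    have "operation B ?ys (sym_type sch s) (Clo [] (LV 0) [(map (PVar \<circ> IV) ?ys @ map PVar [LV 1], e)])"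
    proof (rule operation_equation[OF ys])
      fix \<rho> \<sigma> as
      assume *: "ivals B (set ?ys) \<rho> \<sigma>" "\<And>y. \<sigma> y = Var y \<or> fv_trm (\<sigma> y) = {}"
        "\<And>y. y \<notin> set ?ys \<Longrightarrow> \<sigma> y = Var y"
        "\<And>z. z \<in> set [LV 1] \<Longrightarrow> map_of \<rho> z = map_of (zip [LV 1] as) z"
        "list_all2 (entry_arg B \<sigma>) (entries (sym_type sch s)) as"
      then obtain g where g: "as = [g]" "entry_arg B \<sigma> en g"
        by (auto simp: en list_all2_Cons1)
      show "\<exists>v. eval \<rho> e v \<and> ground B (sub \<sigma> (codom (sym_type sch s))) v"
        by (rule step[OF *(1-3) _ g(2)]) (use *(4) g in \<open>auto intro!: eval_EVar\<close>)
    qed (use en in auto)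
    then show ?thesis by (simp add: prim_op1_def)
  qed
  show ?thesis
  proof (cases s)
    case (SymAndI A1 A2)
    have "operation B ?ys (sym_type sch s) (Clo [] (LV 0)
        [(map (PVar \<circ> IV) ?ys @ map PVar [LV 1, LV 2], ECon CAndI [EVar (LV 1), EVar (LV 2)])])"
    proof (rule operation_equation[OF ys])
      fix \<rho> \<sigma> as
      assume *: "\<And>z. z \<in> set [LV 1, LV 2] \<Longrightarrow> map_of \<rho> z = map_of (zip [LV 1, LV 2] as) z"
        "list_all2 (entry_arg B \<sigma>) (entries (sym_type sch s)) as"
      then obtain g1 g2 where g: "as = [g1, g2]" "ground B (sub \<sigma> A1) g1" "ground B (sub \<sigma> A2) g2"
        by (auto simp: SymAndI list_all2_Cons1)
      have "eval \<rho> (ECon CAndI [EVar (LV 1), EVar (LV 2)]) (Con CAndI [g1, g2])"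
        using *(1) g(1) by (auto intro!: eval_ECon eval_EVar)
      then show "\<exists>v. eval \<rho> (ECon CAndI [EVar (LV 1), EVar (LV 2)]) v \<and>
          ground B (sub \<sigma> (codom (sym_type sch s))) v"
        using g by (auto simp: SymAndI)
    qed (auto simp: SymAndI)
    then show ?thesis using op by (simp add: SymAndI prim_op2_def)
  next
    case (SymOrI1 A1 A2)
    have "operation B ?ys (sym_type sch s)
        (prim_op1 ?ys (ECon COrI1 [x_fm (set ?ys) A1, x_fm (set ?ys) A2, EVar (LV 1)]))"
    proof (rule op1)
      fix \<rho> \<sigma> g
      assume *: "ivals B (set ?ys) \<rho> \<sigma>" "\<And>y. y \<notin> set ?ys \<Longrightarrow> \<sigma> y = Var y"
        "eval \<rho> (EVar (LV 1)) g" "entry_arg B \<sigma> (Entry [] [] A1) g"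
      have "eval \<rho> (ECon COrI1 [x_fm (set ?ys) A1, x_fm (set ?ys) A2, EVar (LV 1)])
          (Con COrI1 [q_fm (sub \<sigma> A1), q_fm (sub \<sigma> A2), g])"
        using xfm[OF *(1,2)] *(3) by (intro eval_ECon) auto
      then show "\<exists>v. eval \<rho> (ECon COrI1 [x_fm (set ?ys) A1, x_fm (set ?ys) A2, EVar (LV 1)]) v \<and>
          ground B (sub \<sigma> (codom (sym_type sch s))) v"
        using *(4) by (auto simp: SymOrI1)
    qed (simp add: SymOrI1)
    then show ?thesis using op by (simp add: SymOrI1)
  next
    case (SymOrI2 A1 A2)
    have "operation B ?ys (sym_type sch s)
        (prim_op1 ?ys (ECon COrI2 [x_fm (set ?ys) A1, x_fm (set ?ys) A2, EVar (LV 1)]))"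
    proof (rule op1)
      fix \<rho> \<sigma> g
      assume *: "ivals B (set ?ys) \<rho> \<sigma>" "\<And>y. y \<notin> set ?ys \<Longrightarrow> \<sigma> y = Var y"
        "eval \<rho> (EVar (LV 1)) g" "entry_arg B \<sigma> (Entry [] [] A2) g"
      have "eval \<rho> (ECon COrI2 [x_fm (set ?ys) A1, x_fm (set ?ys) A2, EVar (LV 1)])
          (Con COrI2 [q_fm (sub \<sigma> A1), q_fm (sub \<sigma> A2), g])"
        using xfm[OF *(1,2)] *(3) by (intro eval_ECon) auto
      then show "\<exists>v. eval \<rho> (ECon COrI2 [x_fm (set ?ys) A1, x_fm (set ?ys) A2, EVar (LV 1)]) v \<and>
          ground B (sub \<sigma> (codom (sym_type sch s))) v"
        using *(4) by (auto simp: SymOrI2)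
    qed (simp add: SymOrI2)
    then show ?thesis using op by (simp add: SymOrI2)
  next
    case (SymImpI A1 A2)
    have "operation B ?ys (sym_type sch s) (prim_op1 ?ys (ECon CImpI [x_fm (set ?ys) A1, EVar (LV 1)]))"
    proof (rule op1)
      fix \<rho> \<sigma> g
      assume *: "ivals B (set ?ys) \<rho> \<sigma>" "\<And>y. y \<notin> set ?ys \<Longrightarrow> \<sigma> y = Var y"
        "eval \<rho> (EVar (LV 1)) g" "entry_arg B \<sigma> (Entry [] [A1] A2) g"
      have "eval \<rho> (ECon CImpI [x_fm (set ?ys) A1, EVar (LV 1)]) (Con CImpI [q_fm (sub \<sigma> A1), g])"
        using xfm[OF *(1,2)] *(3) by (intro eval_ECon) auto
      \<comment> \<open>For an entry that discharges \<open>A1\<close> and binds no individual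
        variable, \<open>entry_arg\<close> unfolds to the condition on \<open>f\<close> in the
        clause of \<open>ground\<close> for \<open>Imp\<close>.\<close>
      then show "\<exists>v. eval \<rho> (ECon CImpI [x_fm (set ?ys) A1, EVar (LV 1)]) v \<and>
          ground B (sub \<sigma> (codom (sym_type sch s))) v"
        using *(4) by (auto simp: SymImpI entry_arg_def list_all2_Cons1)
    qed (simp add: SymImpI)
    then show ?thesis using op by (simp add: SymImpI)
  next
    case (SymExI x t A)
    have "operation B ?ys (sym_type sch s) (prim_op1 ?ys (ECon CExI [x_trm (set ?ys) t, EVar (LV 1)]))"
    proof (rule op1)
      fix \<rho> \<sigma> g
      assume *: "ivals B (set ?ys) \<rho> \<sigma>" "\<And>y. \<sigma> y = Var y \<or> fv_trm (\<sigma> y) = {}"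
        "\<And>y. y \<notin> set ?ys \<Longrightarrow> \<sigma> y = Var y"
        "eval \<rho> (EVar (LV 1)) g" "entry_arg B \<sigma> (Entry [] [] (subst x t A)) g"
      \<comment> \<open>Through \<open>sym_trms\<close> the variable of the displayed term is an
        argument of the operation even if \<open>x\<close> does not occur in
        \<open>A\<close>.\<close>
      have t: "fv_trm t \<subseteq> set ?ys" by (auto simp: set_sym_vars fv_sym_def SymExI)
      \<comment> \<open>The clause for \<open>Ex\<close> wants a constant of the base: a variable
        takes the name of an individual, which \<open>bname\<close> sends to such a constant, and a
        constant \<open>t\<close> is covered by well-formedness.\<close>
      have "\<exists>c. sub_trm \<sigma> t = Cst c \<and> c \<in> consts_of (blang B)"
      proof (cases t)
        case (Var y)
        with t *(1) show ?thesis
          using base by (fastforce simp: ivals_def atomic_base_def dest: bij_betwE)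
      next
        case (Cst c)
        with wf show ?thesis by (simp add: SymExI)
      qed
      then obtain c where c: "sub_trm \<sigma> t = Cst c" "c \<in> consts_of (blang B)" by auto
      have "eval \<rho> (ECon CExI [x_trm (set ?ys) t, EVar (LV 1)]) (Con CExI [q_trm (Cst c), g])"
        using xtrm[OF *(1,3), of t] *(4) c by (intro eval_ECon) auto
      \<comment> \<open>\<open>subst x t\<close> before instantiation and
        \<open>subst x (Cst c)\<close> after it both amount to \<open>\<sigma>(x := Cst c)\<close>,
        by \<open>sub_subst\<close> and \<open>subst_closed_sub\<close>.\<close>
      moreover have "ground B (subst x (Cst c) (sub (\<sigma>(x := Var x)) A)) g"
        using *(5) wf c subst_closed_sub[OF *(2), of x "Cst c" A] by (simp add: SymExI sub_subst)
      ultimately show "\<exists>v. eval \<rho> (ECon CExI [x_trm (set ?ys) t, EVar (LV 1)]) v \<and>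
          ground B (sub \<sigma> (codom (sym_type sch s))) v"
        using c(2) by (auto simp: SymExI)
    qed (simp add: SymExI)
    then show ?thesis using op by (simp add: SymExI)
  next
    case (SymAllI x A)
    have "operation B ?ys (sym_type sch s) (prim_op1 ?ys (ECon CAllI [EVar (LV 1)]))"
    proof (rule op1)
      fix \<rho> \<sigma> g
      assume *: "\<And>y. \<sigma> y = Var y \<or> fv_trm (\<sigma> y) = {}"
        "eval \<rho> (EVar (LV 1)) g" "entry_arg B \<sigma> (Entry [x] [] A) g"
      have "eval \<rho> (ECon CAllI [EVar (LV 1)]) (Con CAllI [g])"
        using *(2) by (intro eval_ECon) auto
      \<comment> \<open>The argument is applied to one individual and no grounds;
        \<open>sub_bnd_single\<close> rewrites the resulting instance into that of the clause for
        \<open>All\<close>.\<close>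
      moreover have "\<exists>v. app g [ind B d] v \<and>
          ground B (subst x (Cst (bname B d)) (sub (\<sigma>(x := Var x)) A)) v" if "d \<in> bdom B" for d
        using *(3)[unfolded entry_arg_def, rule_format, of "[d]" "[]"] that
        by (auto simp: sub_bnd_single[OF *(1)] simp del: fun_upd_apply)
      ultimately show "\<exists>v. eval \<rho> (ECon CAllI [EVar (LV 1)]) v \<and>
          ground B (sub \<sigma> (codom (sym_type sch s))) v"
        by (auto simp: SymAllI)
    qed (simp add: SymAllI)
    then show ?thesis using op by (simp add: SymAllI)
  next
    case (SymBot A)
    \<comment> \<open>No ground for \<open>Bot\<close> exists, so no argument list is admissible and
      the function without equations is vacuously total.\<close>
    show ?thesis using ys by (auto simp: SymBot operation_def list_all2_Cons1)
  next
    case (NonPrim n \<mu>)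
    with op show ?thesis by simp
  qed
qed

section \<open>Denotations of terms\<close>

lemma id_op_operation:
  "operation B (sorted_list_of_set (fv A)) (OpT [Entry [] [] A] A) (id_op A)"
proof -
  let ?ys = "sorted_list_of_set (fv A)"
  have "operation B ?ys (OpT [Entry [] [] A] A)
      (Clo [] (LV 0) [(map (PVar \<circ> IV) ?ys @ map PVar [LV 1], EVar (LV 1))])"
  proof (rule operation_equation)
    fix \<rho> \<sigma> as
    assume *: "\<And>z. z \<in> set [LV 1] \<Longrightarrow> map_of \<rho> z = map_of (zip [LV 1] as) z"
      "list_all2 (entry_arg B \<sigma>) (entries (OpT [Entry [] [] A] A)) as"
    then obtain g where g: "as = [g]" "ground B (sub \<sigma> A) g" by (auto simp: list_all2_Cons1)
    moreover have "eval \<rho> (EVar (LV 1)) g" using * g by (auto intro!: eval_EVar)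
    ultimately show "\<exists>v. eval \<rho> (EVar (LV 1)) v \<and> ground B (sub \<sigma> (codom (OpT [Entry [] [] A] A))) v"
      by auto
  qed (auto simp: finite_fv fv_oty_def fv_entry_def)
  then show ?thesis by (simp add: id_op_def)
qed

text \<open>For non-primitive symbols this is part of \<open>alphabet_denotation\<close>; a
  primitive symbol denotes its \<open>prim_op\<close>, covered by
  \<open>prim_op_operation\<close>.\<close>

lemma symbol_operation:
  assumes "atomic_base B" "grounding_language B \<Lambda>" "alphabet_denotation B \<Lambda> dstar" "s \<in> syms \<Lambda>"
  shows "operation B (sym_vars (schemes \<Lambda>) s) (sym_type (schemes \<Lambda>) s) (dstar (ASym s))"
proof (cases "prim_op (sym_vars (schemes \<Lambda>) s) s")
  case None
  with assms show ?thesis by (auto simp: alphabet_denotation_def split: option.splits)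
next
  case (Some f)
  then have "dstar (ASym s) = f" using assms by (auto simp: alphabet_denotation_def split: option.splits)
  then show ?thesis using Some assms(1,2,4) unfolding grounding_language_def by (blast intro: prim_op_operation)
qed

section \<open>Derivations and free variables of typed terms\<close>

lemma derivation_closed: "derivation S D \<Longrightarrow> fv (concl D) = {}"
  by (auto elim: derivation.cases)

text \<open>Substitution turns atoms into atoms and fixes \<open>Bot\<close>, so the form is
  inherited from the conclusion of the last rule.\<close>

lemma derivation_concl:
  assumes "atomic_system S" "derivation S D"
  shows "is_atom (concl D) \<or> concl D = Bot"
  using assms(2)
proof cases
  case (1 As B Ds \<theta> A)
  with assms(1) have "is_atom B \<or> B = Bot" by (auto simp: atomic_system_def)
  then show ?thesis using 1 by (auto simp: is_atom_def)
qed

lemma FVI_type: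
  assumes "grounding_language B \<Lambda>" "has_type B \<Lambda> U A"
  shows "fv A \<subseteq> FVI \<Lambda> U"
  using assms(2)
proof cases
  case (1 i D)
  then show ?thesis using assms(1) derivation_closed by (auto simp: grounding_language_def)
qed (auto simp: fv_sym_def fv_oty_def)

lemma FVI_TOp:
  assumes "i < length Us" "length Us = length (entries (sym_type (schemes \<Lambda>) s))"
  shows "FVI \<Lambda> (Us ! i) - set (ebind (entries (sym_type (schemes \<Lambda>) s) ! i)) \<subseteq> FVI \<Lambda> (TOp s \<xi>ss Us)"
  using assms by (auto simp: set_zip)

lemma FVT_TOp:
  assumes "i < length Us" "length Us = length \<xi>ss"
  shows "FVT (Us ! i) - set (\<xi>ss ! i) \<subseteq> FVT (TOp s \<xi>ss Us)"
  using assms by (auto simp: set_zip)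

text \<open>By the eigenvariable restriction, an entry binds no variable of the type of an
  assumption left undischarged there, so such variables stay free in the compound term.\<close>

lemma FVI_FVT:
  assumes "has_type B \<Lambda> U A" "\<xi> \<in> FVT U"
  shows "fv (snd \<xi>) \<subseteq> FVI \<Lambda> U"
  using assms
proof (induction arbitrary: \<xi>)
  case (3 s es \<xi>ss Us)
  from 3(6) obtain i where i: "i < length Us" "\<xi> \<in> FVT (Us ! i)" "\<xi> \<notin> set (\<xi>ss ! i)"
    using 3(3,4) by (auto simp: set_zip)
  then have "fv (snd \<xi>) \<subseteq> FVI \<Lambda> (Us ! i) - set (ebind (es ! i))"
    using 3(4,5) by fastforce
  then show ?case using FVI_TOp[of i Us \<Lambda> s \<xi>ss] i 3(2,4) by blast
qed auto

lemma ivals_mono: "ivals B V \<rho> \<sigma> \<Longrightarrow> V' \<subseteq> V \<Longrightarrow> ivals B V' \<rho> \<sigma>"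
  by (auto simp: ivals_def)

lemma tvals_mono: "tvals B W \<rho> \<sigma> \<Longrightarrow> W' \<subseteq> W \<Longrightarrow> tvals B W' \<rho> \<sigma>"
  by (auto simp: tvals_def)

text \<open>Valuations of individuals look up \<open>IV\<close> keys only, so the self-reference
  that a closure puts at \<open>LV 0\<close> is invisible to them.\<close>

lemma ivals_lookup_cong:
  "ivals B V \<rho> \<sigma> \<Longrightarrow> (\<And>y. y \<noteq> LV 0 \<Longrightarrow> map_of \<rho>' y = map_of \<rho> y) \<Longrightarrow> ivals B V \<rho>' \<sigma>"
  by (auto simp: ivals_def)

lemma tvals_lookup_cong:
  "tvals B W \<rho> \<sigma> \<Longrightarrow> (\<And>y. y \<noteq> LV 0 \<Longrightarrow> map_of \<rho>' y = map_of \<rho> y) \<Longrightarrow> tvals B W \<rho>' \<sigma>"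
  by (auto simp: tvals_def)

text \<open>Shared by typed variables, with the identity operation, and by compound terms: the
  values of the argument expressions are collected into lists to which \<open>operation_app\<close>
  applies.\<close>

lemma operation_eval:
  assumes op: "operation B ys \<tau> f" and vals: "ivals B (set ys) \<rho> \<sigma>"
    and es: "list_all2 (\<lambda>en e. \<exists>a. eval \<rho> e a \<and> entry_arg B \<sigma> en a) (entries \<tau>) es"
  shows "\<exists>v. eval \<rho> (EApp (EVal f) (map (EVar \<circ> IV) ys @ es)) v \<and> ground B (sub \<sigma> (codom \<tau>)) v"
proof -
  from vals obtain d where d: "\<And>y. y \<in> set ys \<Longrightarrow>
      d y \<in> bdom B \<and> \<sigma> y = Cst (bname B (d y)) \<and> map_of \<rho> (IV y) = Some (ind B (d y))"
    unfolding ivals_def by metis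
  from es have "\<exists>as. list_all2 (eval \<rho>) es as \<and> list_all2 (entry_arg B \<sigma>) (entries \<tau>) as"
    by (induction rule: list_all2_induct) (auto intro: list_all2_Cons[THEN iffD2])
  then obtain as where as: "list_all2 (eval \<rho>) es as" "list_all2 (entry_arg B \<sigma>) (entries \<tau>) as"
    by auto
  with operation_app[OF op, of d \<sigma> as] d obtain v where
    v: "app f (map (\<lambda>y. ind B (d y)) ys @ as) v" "ground B (sub \<sigma> (codom \<tau>)) v"
    by auto
  have "list_all2 (eval \<rho>) (map (EVar \<circ> IV) ys @ es) (map (\<lambda>y. ind B (d y)) ys @ as)"
    using as(1) d by (intro list_all2_appendI) (auto simp: list_all2_conv_all_nth intro!: eval_EVar)
  then show ?thesis using v eval_EApp[OF eval_EVal] by blast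
qed

lemma den_exp_ground:
  assumes base: "atomic_base B" and lang: "grounding_language B \<Lambda>"
    and den: "alphabet_denotation B \<Lambda> dstar"
    and "has_type B \<Lambda> U A" "ivals B (FVI \<Lambda> U) \<rho> \<sigma>" "tvals B (FVT U) \<rho> \<sigma>"
  shows "\<exists>v. eval \<rho> (den_exp \<Lambda> dstar U) v \<and> ground B (sub \<sigma> A) v"
  using assms(4-6)
proof (induction arbitrary: \<rho> \<sigma>)
  case (1 i D)
  with lang have D: "derivation (bsys B) D" "concl D \<noteq> Bot"
    by (auto simp: grounding_language_def)
  \<comment> \<open>Derivations of \<open>Bot\<close> have no names, so the conclusion is an atom
    and the derivation a ground for it. Being closed, the atom is its own instance.\<close>
  moreover have "is_atom (concl D) \<or> concl D = Bot"
    using base D derivation_concl by (auto simp: atomic_base_def)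
  ultimately have "ground B (concl D) (q_deriv D)" by (auto simp: is_atom_def)
  moreover have "dstar (ADelta i) = q_deriv D" using den 1 by (simp add: alphabet_denotation_def)
  ultimately show ?case using D by (auto simp: sub_closed derivation_closed intro: eval_EVal)
next
  case (2 A i)
  obtain g where "map_of \<rho> (TV (i, A)) = Some g" "ground B (sub \<sigma> A) g"
    using 2 by (auto simp: tvals_def)
  then have "list_all2 (\<lambda>en e. \<exists>a. eval \<rho> e a \<and> entry_arg B \<sigma> en a)
      (entries (OpT [Entry [] [] A] A)) [EVar (TV (i, A))]"
    using eval_EVar by fastforce
  moreover have "ivals B (set (sorted_list_of_set (fv A))) \<rho> \<sigma>" using 2 by (simp add: finite_fv)
  ultimately have "\<exists>v. eval \<rho> (EApp (EVal (id_op A))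
      (map (EVar \<circ> IV) (sorted_list_of_set (fv A)) @ [EVar (TV (i, A))])) v \<and> ground B (sub \<sigma> A) v"
    using operation_eval[OF id_op_operation] by fastforce
  moreover have "dstar (AVar (i, A)) = id_op A" using den 2 by (simp add: alphabet_denotation_def)
  ultimately show ?case by (simp only: den_exp.simps snd_conv)
next
  case (3 s es \<xi>ss Us)
  let ?ys = "sym_vars (schemes \<Lambda>) s" and ?\<tau> = "sym_type (schemes \<Lambda>) s"
  let ?es = "map (\<lambda>((en, \<xi>s), e). lam (map IV (ebind en) @ map TV \<xi>s) e)
    (zip (zip (entries ?\<tau>) \<xi>ss) (map (den_exp \<Lambda> dstar) Us))"
  have "\<exists>a. eval \<rho> (?es ! i) a \<and> entry_arg B \<sigma> (entries ?\<tau> ! i) a" if i: "i < length es" for i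
  proof -
    let ?xs = "ebind (es ! i)" and ?\<xi>s = "\<xi>ss ! i" and ?e = "den_exp \<Lambda> dstar (Us ! i)"
    have IH: "\<exists>v. eval \<rho>' ?e v \<and> ground B (sub \<sigma>' (econ (es ! i))) v"
      if "ivals B (FVI \<Lambda> (Us ! i)) \<rho>' \<sigma>'" "tvals B (FVT (Us ! i)) \<rho>' \<sigma>'" for \<rho>' \<sigma>'
      using 3(5) i that by blast
    have snd: "map snd ?\<xi>s = edis (es ! i)" using 3(5) i by blast
    have eigen: "fv (snd \<xi>) \<inter> set ?xs = {}" if "\<xi> \<in> FVT (Us ! i) - set ?\<xi>s" for \<xi>
      using 3(5) i that by blast
    \<comment> \<open>The abstraction runs its body in an environment known only to agree with
      \<open>\<rho>\<close> off \<open>LV 0\<close>, hence the arbitrary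
      \<open>\<rho>'\<close>.\<close>
    have body: "\<exists>v. eval (zip (map IV ?xs @ map TV ?\<xi>s) (map (ind B) ds @ gs) @ \<rho>') ?e v \<and>
        ground B (sub (bnd B ?xs ds \<sigma>) (econ (es ! i))) v"
      if \<rho>': "\<And>y. y \<noteq> LV 0 \<Longrightarrow> map_of \<rho>' y = map_of \<rho> y"
        and ds: "length ds = length ?xs" "set ds \<subseteq> bdom B"
        and gs: "list_all2 (\<lambda>A. ground B (sub (bnd B ?xs ds \<sigma>) A)) (edis (es ! i)) gs"
      for \<rho>' ds gs
    proof (rule IH)
      have "ivals B (FVI \<Lambda> (Us ! i) - set ?xs) \<rho> \<sigma>"
        by (rule ivals_mono[OF 3(6)]) (use FVI_TOp[of i Us \<Lambda> s \<xi>ss] i 3(2,4) in \<open>simp only:\<close>)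
      then have "ivals B (FVI \<Lambda> (Us ! i) - set ?xs) \<rho>' \<sigma>"
        by (rule ivals_lookup_cong) (rule \<rho>')
      then show "ivals B (FVI \<Lambda> (Us ! i)) (zip (map IV ?xs @ map TV ?\<xi>s) (map (ind B) ds @ gs) @ \<rho>')
          (bnd B ?xs ds \<sigma>)"
        using ds by (intro ivals_bind) auto
      have "tvals B (FVT (Us ! i) - set ?\<xi>s) \<rho> \<sigma>"
        by (rule tvals_mono[OF 3(7)]) (use FVT_TOp[of i Us \<xi>ss s] i 3(3,4) in \<open>simp only:\<close>)
      then have "tvals B (FVT (Us ! i) - set ?\<xi>s) \<rho>' \<sigma>"
        by (rule tvals_lookup_cong) (rule \<rho>')
      moreover have "length gs = length ?\<xi>s"
        using gs snd by (metis length_map list_all2_lengthD)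
      ultimately show "tvals B (FVT (Us ! i))
          (zip (map IV ?xs @ map TV ?\<xi>s) (map (ind B) ds @ gs) @ \<rho>') (bnd B ?xs ds \<sigma>)"
        using ds gs by (intro tvals_bind eigen) (simp_all add: snd)
    qed
    \<comment> \<open>If the entry binds nothing, \<open>lam\<close> builds no function;
      \<open>body\<close> with empty lists supplies the value that is then required.\<close>
    have ex: "\<exists>v. eval \<rho> ?e v" if "map IV ?xs @ map TV ?\<xi>s = []"
      using body[of \<rho> "[]" "[]"] that snd by auto
    obtain a \<rho>' where a: "eval \<rho> (lam (map IV ?xs @ map TV ?\<xi>s) ?e) a"
      "\<And>y. y \<noteq> LV 0 \<Longrightarrow> map_of \<rho>' y = map_of \<rho> y"
      "\<And>vs v. length vs = length (map IV ?xs @ map TV ?\<xi>s) \<Longrightarrow>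
         eval (zip (map IV ?xs @ map TV ?\<xi>s) vs @ \<rho>') ?e v \<Longrightarrow> app a vs v"
      by (rule eval_lam[OF ex]) (assumption, rule that)
    have "entry_arg B \<sigma> (es ! i) a"
      unfolding entry_arg_def
    proof (intro allI impI, elim conjE)
      fix ds gs
      assume *: "length ds = length ?xs" "set ds \<subseteq> bdom B"
        "list_all2 (\<lambda>A. ground B (sub (bnd B ?xs ds \<sigma>) A)) (edis (es ! i)) gs"
      then have "length (map (ind B) ds @ gs) = length (map IV ?xs @ map TV ?\<xi>s)"
        using snd by (metis length_append length_map list_all2_lengthD)
      then show "\<exists>v. app a (map (ind B) ds @ gs) v \<and> ground B (sub (bnd B ?xs ds \<sigma>) (econ (es ! i))) v"
        using body[OF a(2) *] a(3) by blast
    qed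
    moreover have "?es ! i = lam (map IV ?xs @ map TV ?\<xi>s) ?e" using 3(2-4) i by simp
    ultimately show ?thesis using a(1) 3(2) by auto
  qed
  moreover have "length ?es = length es" using 3(2-4) by simp
  ultimately have "list_all2 (\<lambda>en e. \<exists>a. eval \<rho> e a \<and> entry_arg B \<sigma> en a) (entries ?\<tau>) ?es"
    using 3(2) by (auto simp: list_all2_conv_all_nth)
  moreover have "ivals B (set ?ys) \<rho> \<sigma>" using 3(6) by (auto simp: ivals_def set_sym_vars)
  ultimately show ?case
    using operation_eval[OF symbol_operation[OF base lang den 3(1)]] by auto
qed

section \<open>Denotations as operations on individuals and assumptions\<close>

theorem theorem14:
  fixes B :: "'d base" and \<Lambda> :: glang and dstar :: "alph \<Rightarrow> val"
    and U :: tm and \<beta> :: fm and xs :: "nat list" and \<xi>s :: "tvar list" and \<Gamma> :: "fm list"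
  assumes "atomic_base B"
    and "grounding_language B \<Lambda>"
    and "alphabet_denotation B \<Lambda> dstar"
    and "has_type B \<Lambda> U \<beta>"
    and "FVI \<Lambda> U = set xs" and "distinct xs"
    and "FVT U = set \<xi>s" and "distinct \<xi>s"
    and "set \<Gamma> = snd ` FVT U" and "distinct \<Gamma>"
  shows "ground_for B xs \<Gamma> \<beta> (den \<Lambda> dstar xs \<xi>s \<Gamma> U)"
proof -
  let ?e = "den_exp \<Lambda> dstar U"
  \<comment> \<open>The outer arguments are indexed by formulas; the inner abstraction hands the one
    ground for a formula to all typed variables of that type.\<close>
  let ?b = "EApp (lam (map TV \<xi>s) ?e) (map (EVar \<circ> FV \<circ> snd) \<xi>s)"
  have body: "\<exists>v. eval (zip (map IV xs @ map FV \<Gamma>) (map (ind B) ds @ gs) @ \<rho>') ?b v \<and>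
      ground B (sub (bnd B xs ds Var) \<beta>) v"
    if ds: "length ds = length xs" "set ds \<subseteq> bdom B"
      and gs: "list_all2 (\<lambda>A. ground B (sub (bnd B xs ds Var) A)) \<Gamma> gs" for \<rho>' ds gs
  proof -
    let ?\<rho> = "zip (map IV xs @ map FV \<Gamma>) (map (ind B) ds @ gs) @ \<rho>'" and ?\<sigma> = "bnd B xs ds Var"
    have ivals: "ivals B (FVI \<Lambda> U) ?\<rho> ?\<sigma>"
      using ds assms(5) by (intro ivals_bind) (auto simp: ivals_def)
    have "\<exists>g. map_of ?\<rho> (FV A) = Some g \<and> ground B (sub ?\<sigma> A) g" if "A \<in> set \<Gamma>" for A
    proof -
      obtain g where g: "map_of (zip \<Gamma> gs) A = Some g"
        using \<open>A \<in> set \<Gamma>\<close> gs by (metis list_all2_lengthD map_of_zip_is_Some)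
      then have "(A, g) \<in> set (zip \<Gamma> gs)" by (rule map_of_SomeD)
      then have "ground B (sub ?\<sigma> A) g" using gs by (auto simp: list_all2_iff)
      moreover have "map_of (zip (map FV \<Gamma>) gs) (FV A) = Some g"
        using map_of_zip_map[of FV \<Gamma> id gs A] g by (simp add: inj_def option.map_id)
      moreover have "map_of (zip (map IV xs) (map (ind B) ds)) (FV A) = None"
        by (intro map_of_zip_notin) auto
      ultimately show ?thesis using ds by (auto simp: map_add_def simp del: map_of_zip_is_None)
    qed
    \<comment> \<open>\<open>\<Gamma>\<close> contains the type of every variable in
      \<open>\<xi>s\<close>, so each finds its ground at the place of its type.\<close>
    then have "\<forall>\<xi>\<in>set \<xi>s. \<exists>g. map_of ?\<rho> (FV (snd \<xi>)) = Some g \<and> ground B (sub ?\<sigma> (snd \<xi>)) g"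
      using assms(7,9) by auto
    then obtain g where g: "\<And>\<xi>. \<xi> \<in> set \<xi>s \<Longrightarrow>
        map_of ?\<rho> (FV (snd \<xi>)) = Some (g \<xi>) \<and> ground B (sub ?\<sigma> (snd \<xi>)) (g \<xi>)"
      by metis
    have inner: "\<exists>v. eval (zip (map TV \<xi>s) (map g \<xi>s) @ \<rho>'') ?e v \<and> ground B (sub ?\<sigma> \<beta>) v"
      if \<rho>'': "\<And>y. y \<noteq> LV 0 \<Longrightarrow> map_of \<rho>'' y = map_of ?\<rho> y" for \<rho>''
    proof -
      have "ivals B (FVI \<Lambda> U) \<rho>'' ?\<sigma>" using ivals_lookup_cong[OF ivals \<rho>''] .
      then have "ivals B (FVI \<Lambda> U) (zip (map TV \<xi>s) (map g \<xi>s) @ \<rho>'') ?\<sigma>"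
        using ivals_bind[of "[]" "[]" B "FVI \<Lambda> U" \<rho>'' ?\<sigma> "map TV \<xi>s" "map g \<xi>s"] by auto
      moreover have "list_all2 (\<lambda>A. ground B (sub ?\<sigma> A)) (map snd \<xi>s) (map g \<xi>s)"
        using g by (auto simp: list_all2_conv_all_nth)
      \<comment> \<open>The inner abstraction binds no individual variables, so the eigenvariable
        condition of \<open>tvals_bind\<close> holds trivially.\<close>
      then have "tvals B (FVT U) (zip (map TV \<xi>s) (map g \<xi>s) @ \<rho>'') ?\<sigma>"
        using tvals_bind[of "[]" "[]" "map g \<xi>s" \<xi>s B ?\<sigma> "FVT U" \<rho>''] assms(7)
        by (auto simp: tvals_def)
      ultimately show ?thesis using den_exp_ground[OF assms(1-4)] by blast
    qed
    have ex: "\<exists>v. eval ?\<rho> ?e v" if "map TV \<xi>s = []" using inner[of ?\<rho>] that by auto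
    obtain u \<rho>'' where u: "eval ?\<rho> (lam (map TV \<xi>s) ?e) u"
      "\<And>y. y \<noteq> LV 0 \<Longrightarrow> map_of \<rho>'' y = map_of ?\<rho> y"
      "\<And>vs v. length vs = length (map TV \<xi>s) \<Longrightarrow> eval (zip (map TV \<xi>s) vs @ \<rho>'') ?e v \<Longrightarrow> app u vs v"
      by (rule eval_lam[OF ex]) (assumption, rule that)
    obtain v where "eval (zip (map TV \<xi>s) (map g \<xi>s) @ \<rho>'') ?e v"
      and v: "ground B (sub ?\<sigma> \<beta>) v"
      using inner[OF u(2)] by blast
    then have app: "app u (map g \<xi>s) v" by (intro u(3)) auto
    have "list_all2 (eval ?\<rho>) (map (EVar \<circ> FV \<circ> snd) \<xi>s) (map g \<xi>s)"
      unfolding list.rel_map by (rule list.rel_refl_strong) (simp only: o_def eval_EVar g)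
    then show ?thesis using eval_EApp[OF u(1) _ app] v by blast
  qed
  \<comment> \<open>With no arguments the denotation is the value of \<open>?b\<close> itself, which
    must therefore exist.\<close>
  have ex: "\<exists>v. eval [] ?b v" if "map IV xs @ map FV \<Gamma> = []"
    using body[of "[]" "[]" "[]"] that by auto
  obtain u \<rho>' where u: "eval [] (lam (map IV xs @ map FV \<Gamma>) ?b) u"
    "\<And>vs v. length vs = length (map IV xs @ map FV \<Gamma>) \<Longrightarrow>
       eval (zip (map IV xs @ map FV \<Gamma>) vs @ \<rho>') ?b v \<Longrightarrow> app u vs v"
    by (rule eval_lam[OF ex]) (assumption, rule that)
  \<comment> \<open>The description in \<open>den\<close> is proper: \<open>u\<close> is a value,
    and evaluation is determinate.\<close>
  have "den \<Lambda> dstar xs \<xi>s \<Gamma> U = u"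
    unfolding den_def using u(1) eval_det by blast
  moreover have "operation B xs (OpT (map (Entry [] []) \<Gamma>) \<beta>) u"
    unfolding operation_def
  proof (intro conjI allI impI)
    \<comment> \<open>\<open>FVI_type\<close> covers the variables of \<open>\<beta>\<close>, and
      \<open>FVI_FVT\<close> those of the formulas in \<open>\<Gamma>\<close>.\<close>
    show "fv_oty (OpT (map (Entry [] []) \<Gamma>) \<beta>) \<subseteq> set xs"
      using FVI_type[OF assms(2,4)] FVI_FVT[OF assms(4)] assms(5,9)
      by (auto simp: fv_oty_def fv_entry_def)
    fix ds as
    assume "length ds = length xs \<and> set ds \<subseteq> bdom B \<and>
      list_all2 (entry_arg B (bnd B xs ds Var)) (entries (OpT (map (Entry [] []) \<Gamma>) \<beta>)) as"
    then have *: "length ds = length xs" "set ds \<subseteq> bdom B"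
      "list_all2 (\<lambda>A. ground B (sub (bnd B xs ds Var) A)) \<Gamma> as"
      by (auto simp: list_all2_map1)
    then have len: "length (map (ind B) ds @ as) = length (map IV xs @ map FV \<Gamma>)"
      by (auto dest: list_all2_lengthD)
    show "\<exists>v. app u (map (ind B) ds @ as) v \<and>
        ground B (sub (bnd B xs ds Var) (codom (OpT (map (Entry [] []) \<Gamma>) \<beta>))) v"
      using body[OF *, of \<rho>'] u(2)[OF len] by auto
  qed (rule assms(6))
  ultimately show ?thesis by (simp add: ground_for_def)
qed

end
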